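(* For an integer $p\geq 2$ let $r=\lceil\log_2(p-1)\rceil$ and let $g_p$ denote the common value of $\mathrm{forb}(m,3,p\cdot K_2)-\mathrm{forb}(m,3,p\cdot I_2)$ over all integers $m\geq 2r+2$ (this value does not depend on $m$ in that range). Then $g_p\sim \frac12 p(\log_2 p)^2$ as $p\to\infty$, i.e. $g_p\big/\big(\tfrac12 p(\log_2 p)^2\big)\to 1$.
   Context: An $s$-matrix is a matrix with entries in $\{0,1,\dots,s-1\}$; it is simple if it has no repeated columns. $|A|$ denotes the number of columns of $A$. $F\prec A$ means some submatrix of $A$ is a row and column permutation of $F$. $\mathrm{Avoid}(m,s,F)$ is the set of $m$-rowed simple $s$-matrices $A$ with $F\not\prec A$, and $\mathrm{forb}(m,s,F)=\max\{|A|: A\in \mathrm{Avoid}(m,s,F)\}$. $K_2$ is the $2\times 4$ matrix of all $(0,1)$-columns of length 2, $I_2$ the $2\times 2$ identity matrix, and $p\cdot F$ the concatenation of $p$ copies of $F$. *)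

theory Defs
  imports Complex_Main
begin

text \<open>A matrix is represented as the list of its columns; each column is a list
  of entries (one per row).  An m-rowed s-matrix has all columns of length m with
  entries in {0..s-1}.  Simple = no repeated columns.\<close>

type_synonym mat = "nat list list"

definition is_smatrix :: "nat \<Rightarrow> nat \<Rightarrow> mat \<Rightarrow> bool" where
  "is_smatrix m s A \<longleftrightarrow> (\<forall>c \<in> set A. length c = m \<and> (\<forall>x \<in> set c. x < s))"

definition simple :: "mat \<Rightarrow> bool" where
  "simple A \<longleftrightarrow> distinct A"

text \<open>F is a k-rowed matrix. F \<prec> A (with A m-rowed): some submatrix of A is a row and
  column permutation of F, i.e. there are injective choices of k rows and |F| columns
  of A reproducing F entrywise.\<close>

definition config :: "nat \<Rightarrow> mat \<Rightarrow> nat \<Rightarrow> mat \<Rightarrow> bool" where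
  "config k F m A \<longleftrightarrow> (\<exists>f g. inj_on f {..<k} \<and> f ` {..<k} \<subseteq> {..<m}
      \<and> inj_on g {..<length F} \<and> g ` {..<length F} \<subseteq> {..<length A}
      \<and> (\<forall>i<k. \<forall>j<length F. A ! (g j) ! (f i) = F ! j ! i))"

definition Avoid :: "nat \<Rightarrow> nat \<Rightarrow> nat \<Rightarrow> mat \<Rightarrow> mat set" where
  "Avoid m s k F = {A. is_smatrix m s A \<and> simple A \<and> \<not> config k F m A}"

definition forb :: "nat \<Rightarrow> nat \<Rightarrow> nat \<Rightarrow> mat \<Rightarrow> nat" where
  "forb m s k F = Max (length ` Avoid m s k F)"

definition K2 :: mat where "K2 = [[0,0],[0,1],[1,0],[1,1]]"
definition I2 :: mat where "I2 = [[1,0],[0,1]]"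

definition copies :: "nat \<Rightarrow> mat \<Rightarrow> mat" where
  "copies p F = concat (replicate p F)"

definition rnum :: "nat \<Rightarrow> nat" where
  "rnum p = nat \<lceil>log 2 (real p - 1)\<rceil>"

definition gdiff :: "nat \<Rightarrow> nat \<Rightarrow> int" where
  "gdiff m p = int (forb m 3 2 (copies p K2)) - int (forb m 3 2 (copies p I2))"

end

(* Fix an orientation of every pair of rows, or, for K_2, a missing 0-1 pattern for
   every pair. The columns that respect all choices number at most
   b(m) = (m + 2) 2^(m - 1), and every other column uses up one of the p - 1 permitted
   violations of some pair. For K_2 the choice "at most one 1" attains
   b(m) + (p - 1) (m choose 2). For I_2 a cyclic tournament costs 2^(m - 2) columns, which
   is too much, so the choice may be taken to be "all 1s above all 0s". Then a pair i < j
   with d rows outside the interval [i, j] is the only violated pair of just 2^d columns,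
   so that the pairs with d < r cannot all be saturated; their total shortage is g_p. It
   does not depend on m, is at most (p - 1) r (r + 1) / 2, and for every t <= r is at
   least (p - 1) t (t + 1) / 2 minus the number of columns all of whose violated pairs
   have d < t, which is at most t^3 2^(t + 1). *)

theory Submission
  imports Defs "HOL-Library.FuncSet" "HOL-Real_Asymp.Real_Asymp"
begin

text \<open>The constant b(m) solves f(n + 1) = 2 f(n) + 2^n, f(0) = 1, the recursion obtained by
  deleting a row; both extremal choices attain equality. The two numbers differ because of private
  columns, those that violate a single pair: a pair can be filled up to p - 1 independently of all
  others if it has that many. For K_2 every pair has 2^(m - 2). For I_2 a pair has 2^d, and r is the
  least exponent with 2^r >= p - 1. Pairs with d < r are harder, since a column may violate several
  of them at once; their joint optimum is an extremal problem of its own. It is kept as the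
  unevaluated number \<open>max_near\<close>, which enters the lower and the upper bound alike, so
  that g_p is exact in terms of it. The asymptotics need a t with t ~ log_2 p, so that nearly all
  near pairs count, and t^3 2^t = o(p (log_2 p)^2), so that the columns available to these pairs are
  negligible against their quotas.\<close>

section \<open>Configurations made of repeated copies\<close>

lemma length_copies: "length (copies p F) = p * length F"
  by (induction p) (auto simp: copies_def)

lemma nth_copies: "n < p * length F \<Longrightarrow> copies p F ! n = F ! (n mod length F)"
proof (induction p arbitrary: n)
  case (Suc p)
  have eq: "copies (Suc p) F = F @ copies p F" by (simp add: copies_def)
  show ?case
  proof (cases "n < length F")
    case False
    then have "copies (Suc p) F ! n = copies p F ! (n - length F)"
      by (simp add: eq nth_append)
    also have "\<dots> = F ! ((n - length F) mod length F)"
      using Suc False by (intro Suc.IH) auto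
    also have "(n - length F) mod length F = n mod length F"
      using False by (simp add: le_mod_geq)
    finally show ?thesis .
  qed (simp add: eq nth_append)
qed simp

text \<open>Column n of \<open>copies p F\<close> is column \<open>n mod length F\<close> of
  \<open>F\<close>, so p copies demand p columns of \<open>A\<close> for every pattern. Since
  \<open>F\<close> is distinct, one column of \<open>A\<close> cannot serve two patterns, and
  choices made pattern by pattern glue to one injection; since \<open>A\<close> is distinct, columns
  may be counted instead of positions.\<close>

lemma config_copies:
  assumes "distinct F" "distinct A" and len: "\<And>q. q \<in> set F \<Longrightarrow> length q = k"
  shows "config k (copies p F) m A \<longleftrightarrow>
    (\<exists>f. inj_on f {..<k} \<and> f ` {..<k} \<subseteq> {..<m} \<and>
      (\<forall>q\<in>set F. p \<le> card {c \<in> set A. \<forall>i<k. c ! f i = q ! i}))" (is "_ \<longleftrightarrow> ?R")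
proof
  assume "config k (copies p F) m A"
  then obtain f g where f: "inj_on f {..<k}" "f ` {..<k} \<subseteq> {..<m}"
    and g: "inj_on g {..<p * length F}" "g ` {..<p * length F} \<subseteq> {..<length A}"
    and fg: "\<And>i j. i < k \<Longrightarrow> j < p * length F \<Longrightarrow> A ! g j ! f i = F ! (j mod length F) ! i"
    unfolding config_def length_copies by (auto simp: nth_copies)
  have "p \<le> card {c \<in> set A. \<forall>i<k. c ! f i = q ! i}" if q: "q \<in> set F" for q
  proof -
    obtain t where t: "t < length F" "q = F ! t" using q by (auto simp: in_set_conv_nth)
    \<comment> \<open>Position of column \<open>t\<close> within copy number \<open>s\<close> of
      \<open>F\<close>.\<close>
    let ?n = "\<lambda>s. s * length F + t"
    have n: "?n s < p * length F" if "s < p" for s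
    proof -
      have "?n s < Suc s * length F" using t by simp
      also have "\<dots> \<le> p * length F" using that by (intro mult_le_mono1) auto
      finally show ?thesis .
    qed
    have "inj_on (\<lambda>s. A ! g (?n s)) {..<p}"
    proof (rule inj_onI)
      fix s s' assume s: "s \<in> {..<p}" "s' \<in> {..<p}" "A ! g (?n s) = A ! g (?n s')"
      have "g (?n s) < length A" "g (?n s') < length A" using s n g(2) by auto
      then have "g (?n s) = g (?n s')" using s \<open>distinct A\<close> by (simp add: nth_eq_iff_index_eq)
      then have "?n s = ?n s'" using g(1) n s by (auto dest: inj_onD)
      then show "s = s'" using t by auto
    qed
    moreover have "(\<lambda>s. A ! g (?n s)) ` {..<p} \<subseteq> {c \<in> set A. \<forall>i<k. c ! f i = q ! i}"
      using n g(2) fg t by (auto intro!: nth_mem)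
    ultimately have "card {..<p} \<le> card {c \<in> set A. \<forall>i<k. c ! f i = q ! i}"
      by (rule card_inj_on_le) auto
    then show ?thesis by simp
  qed
  then show ?R using f by blast
next
  assume ?R
  then obtain f where f: "inj_on f {..<k}" "f ` {..<k} \<subseteq> {..<m}"
    and card: "\<And>q. q \<in> set F \<Longrightarrow> p \<le> card {c \<in> set A. \<forall>i<k. c ! f i = q ! i}" by blast
  let ?I = "\<lambda>t. {n. n < length A \<and> (\<forall>i<k. A ! n ! f i = F ! t ! i)}"
  have "\<exists>h. inj_on h {..<p} \<and> h ` {..<p} \<subseteq> ?I t" if t: "t < length F" for t
  proof -
    have "{c \<in> set A. \<forall>i<k. c ! f i = F ! t ! i} \<subseteq> (!) A ` ?I t"
      by (auto simp: in_set_conv_nth)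
    then have "card {c \<in> set A. \<forall>i<k. c ! f i = F ! t ! i} \<le> card (?I t)"
      by (rule surj_card_le[rotated]) auto
    then have "card {..<p} \<le> card (?I t)" using card[of "F ! t"] t by simp
    then show ?thesis using card_le_inj[of "{..<p}" "?I t"] by auto
  qed
  then have "\<forall>t. \<exists>h. t < length F \<longrightarrow> inj_on h {..<p} \<and> h ` {..<p} \<subseteq> ?I t" by blast
  from choice[OF this] obtain h where h: "\<And>t. t < length F \<Longrightarrow> inj_on (h t) {..<p}"
    "\<And>t. t < length F \<Longrightarrow> h t ` {..<p} \<subseteq> ?I t" by blast
  define g where "g n = h (n mod length F) (n div length F)" for n
  have nn: "n mod length F < length F" "n div length F < p" if n: "n < p * length F" for n
  proof -
    have "length F \<noteq> 0" using n by auto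
    then show "n mod length F < length F" by simp
    show "n div length F < p" using n by (rule less_mult_imp_div_less)
  qed
  have gI: "g n \<in> ?I (n mod length F)" if "n < p * length F" for n
    using h(2)[OF nn(1)[OF that]] nn(2)[OF that] unfolding g_def by blast
  have "inj_on g {..<p * length F}"
  proof (rule inj_onI)
    fix n n' assume n: "n \<in> {..<p * length F}" "n' \<in> {..<p * length F}" "g n = g n'"
    \<comment> \<open>The same column of \<open>A\<close> shows both patterns on the k chosen rows,
      and patterns have length k.\<close>
    have "F ! (n mod length F) = F ! (n' mod length F)"
    proof (rule nth_equalityI)
      show "length (F ! (n mod length F)) = length (F ! (n' mod length F))"
        using n nn len by simp
      fix i assume "i < length (F ! (n mod length F))"
      then have "i < k" using n nn len by simp
      then show "F ! (n mod length F) ! i = F ! (n' mod length F) ! i"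
        using gI[of n] gI[of n'] n by auto
    qed
    then have m: "n mod length F = n' mod length F"
      using \<open>distinct F\<close> nn n by (simp add: nth_eq_iff_index_eq)
    then have "n div length F = n' div length F"
      using n h(1)[of "n mod length F"] nn unfolding g_def by (auto dest: inj_onD)
    then show "n = n'" using m by (metis div_mult_mod_eq)
  qed
  then show "config k (copies p F) m A"
    unfolding config_def length_copies using f gI
    by (intro exI[of _ f] exI[of _ g]) (auto simp: nth_copies)
qed

section \<open>Matrices as sets of columns\<close>

text \<open>From here on a column is a function on the row indices.\<close>

definition cols :: "nat \<Rightarrow> (nat \<Rightarrow> nat) set" where
  "cols m = {..<m} \<rightarrow>\<^sub>E {..<3}"

lemma finite_cols [simp]: "finite (cols m)"
  by (simp add: cols_def finite_PiE)

definition avoiding :: "nat \<Rightarrow> nat \<Rightarrow> nat \<Rightarrow> mat \<Rightarrow> (nat \<Rightarrow> nat) set set" where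
  "avoiding m k p F = {X. X \<subseteq> cols m \<and>
     \<not> (\<exists>f. inj_on f {..<k} \<and> f ` {..<k} \<subseteq> {..<m} \<and>
         (\<forall>q\<in>set F. p \<le> card {c \<in> X. \<forall>i<k. c (f i) = q ! i}))}"

text \<open>The bijection \<open>?\<phi>\<close> from lists of length m to functions on the row
  indices turns a simple matrix, up to column order, into a set of columns with the same count for
  every pattern.\<close>

lemma forb_copies:
  assumes "distinct F" "\<And>q. q \<in> set F \<Longrightarrow> length q = k"
  shows "forb m 3 k (copies p F) = Max (card ` avoiding m k p F)"
proof -
  let ?L = "{c :: nat list. length c = m \<and> (\<forall>x\<in>set c. x < 3)}"
  let ?\<phi> = "\<lambda>c :: nat list. \<lambda>i\<in>{..<m}. c ! i"
  have inj: "inj_on ?\<phi> ?L"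
  proof (rule inj_onI)
    fix c d assume cd: "c \<in> ?L" "d \<in> ?L" "?\<phi> c = ?\<phi> d"
    have "c ! i = d ! i" if "i < m" for i using that fun_cong[OF cd(3), of i] by simp
    with cd(1,2) show "c = d" by (simp add: list_eq_iff_nth_eq)
  qed
  have img: "?\<phi> ` ?L = cols m"
  proof
    show "cols m \<subseteq> ?\<phi> ` ?L"
    proof
      fix c assume c: "c \<in> cols m"
      have 1: "map c [0..<m] \<in> ?L" using PiE_mem[OF c[unfolded cols_def]] by simp
      have 2: "c = ?\<phi> (map c [0..<m])"
        using PiE_arb[OF c[unfolded cols_def]] by (intro ext) (simp add: restrict_def)
      show "c \<in> ?\<phi> ` ?L" by (rule image_eqI[where x = "map c [0..<m]"]) (rule 2, rule 1)
    qed
    show "?\<phi> ` ?L \<subseteq> cols m"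
      unfolding cols_def by (intro image_subsetI restrict_PiE_iff[THEN iffD2]) auto
  qed
  have tr: "config k (copies p F) m A \<longleftrightarrow>
    (\<exists>f. inj_on f {..<k} \<and> f ` {..<k} \<subseteq> {..<m} \<and>
      (\<forall>q\<in>set F. p \<le> card {c \<in> ?\<phi> ` set A. \<forall>i<k. c (f i) = q ! i}))"
    if A: "distinct A" "set A \<subseteq> ?L" for A
  proof -
    have "card {c \<in> ?\<phi> ` set A. \<forall>i<k. c (f i) = q ! i} = card {c \<in> set A. \<forall>i<k. c ! f i = q ! i}"
      if "f ` {..<k} \<subseteq> {..<m}" for f q
    proof -
      have "{c \<in> ?\<phi> ` set A. \<forall>i<k. c (f i) = q ! i} = ?\<phi> ` {c \<in> set A. \<forall>i<k. c ! f i = q ! i}"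
        using that by (auto simp: image_subset_iff)
      moreover have "inj_on ?\<phi> {c \<in> set A. \<forall>i<k. c ! f i = q ! i}"
        by (rule inj_on_subset[OF inj]) (use A(2) in blast)
      ultimately show ?thesis by (simp add: card_image)
    qed
    note eq = this
    have "config k (copies p F) m A \<longleftrightarrow>
      (\<exists>f. inj_on f {..<k} \<and> f ` {..<k} \<subseteq> {..<m} \<and>
        (\<forall>q\<in>set F. p \<le> card {c \<in> set A. \<forall>i<k. c ! f i = q ! i}))"
      using assms A(1) by (intro config_copies)
    also have "\<dots> \<longleftrightarrow> (\<exists>f. inj_on f {..<k} \<and> f ` {..<k} \<subseteq> {..<m} \<and>
      (\<forall>q\<in>set F. p \<le> card {c \<in> ?\<phi> ` set A. \<forall>i<k. c (f i) = q ! i}))"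
      by (intro ex_cong1 conj_cong refl ball_cong) (simp only: eq)
    finally show ?thesis .
  qed
  have sm: "A \<in> Avoid m 3 k (copies p F) \<longleftrightarrow>
    distinct A \<and> set A \<subseteq> ?L \<and> ?\<phi> ` set A \<in> avoiding m k p F" for A
  proof (cases "distinct A \<and> set A \<subseteq> ?L")
    case True
    then have "?\<phi> ` set A \<subseteq> cols m" using img by blast
    moreover have "is_smatrix m 3 A" using True by (auto simp: is_smatrix_def)
    ultimately show ?thesis
      using True unfolding Avoid_def avoiding_def simple_def mem_Collect_eq
      by (simp only: tr simp_thms)
  next
    case False
    then show ?thesis by (auto simp: Avoid_def is_smatrix_def simple_def)
  qed
  have "length ` Avoid m 3 k (copies p F) = card ` avoiding m k p F"
  proof (intro equalityI image_subsetI)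
    fix A assume "A \<in> Avoid m 3 k (copies p F)"
    then have A: "distinct A" "set A \<subseteq> ?L" "?\<phi> ` set A \<in> avoiding m k p F"
      by (simp_all only: sm)
    then have "card (?\<phi> ` set A) = length A"
      using inj_on_subset[OF inj A(2)] by (simp add: card_image distinct_card)
    then show "length A \<in> card ` avoiding m k p F" using A(3) by (metis imageI)
  next
    fix X assume X: "X \<in> avoiding m k p F"
    then have "X \<subseteq> ?\<phi> ` ?L" unfolding img avoiding_def by blast
    then obtain Y where Y: "Y \<subseteq> ?L" "X = ?\<phi> ` Y" by (rule subset_imageE)
    have "finite X" using X finite_subset[OF _ finite_cols] by (auto simp: avoiding_def)
    then have "finite Y" using Y(2) finite_imageD[OF _ inj_on_subset[OF inj Y(1)]] by simp
    then obtain A where A: "set A = Y" "distinct A" using finite_distinct_list by blast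
    with X Y have "A \<in> Avoid m 3 k (copies p F)" by (simp only: sm)
    moreover have "length A = card X"
      using A Y inj_on_subset[OF inj Y(1)] by (simp add: card_image distinct_card[symmetric])
    ultimately show "card X \<in> length ` Avoid m 3 k (copies p F)" by (metis imageI)
  qed
  then show ?thesis by (simp add: forb_def)
qed

definition occ :: "(nat \<Rightarrow> nat) set \<Rightarrow> nat \<Rightarrow> nat \<Rightarrow> nat \<Rightarrow> nat \<Rightarrow> nat" where
  "occ X a b i j = card {c \<in> X. c i = a \<and> c j = b}"

lemma ex_inj_two:
  "(\<exists>f. inj_on f {..<2::nat} \<and> f ` {..<2} \<subseteq> {..<m::nat} \<and> P (f 0) (f 1)) \<longleftrightarrow>
    (\<exists>i<m. \<exists>j<m. i \<noteq> j \<and> P i j)" (is "?L \<longleftrightarrow> ?R")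
proof
  assume ?R
  then obtain i j where "i < m" "j < m" "i \<noteq> j" "P i j" by blast
  then show ?L by (intro exI[of _ "\<lambda>n. if n = 0 then i else j"])
      (auto simp: inj_on_def numeral_2_eq_2 lessThan_Suc)
qed (auto simp: inj_on_def numeral_2_eq_2 lessThan_Suc)

lemma avoiding_two:
  "avoiding m 2 p F = {X. X \<subseteq> cols m \<and>
     (\<forall>i<m. \<forall>j<m. i \<noteq> j \<longrightarrow> (\<exists>q\<in>set F. occ X (q ! 0) (q ! 1) i j < p))}"
proof -
  have "(\<forall>i<2. c (f i) = q ! i) \<longleftrightarrow> c (f 0) = q ! 0 \<and> c (f (1::nat)) = q ! 1"
    for c f :: "nat \<Rightarrow> nat" and q by (auto simp: less_2_cases_iff)
  then show ?thesis
    unfolding avoiding_def occ_def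
    using ex_inj_two[of m "\<lambda>i j. \<forall>q\<in>set F. p \<le> card {c \<in> X. c i = q ! 0 \<and> c j = q ! 1}" for X]
    by (auto simp: not_le[symmetric])
qed

lemma forb_I2:
  "forb m 3 2 (copies p I2) = Max (card ` {X. X \<subseteq> cols m \<and>
     (\<forall>i<m. \<forall>j<m. i \<noteq> j \<longrightarrow> occ X 0 1 i j < p \<or> occ X 1 0 i j < p)})"
proof -
  have "(\<exists>q\<in>set I2. occ X (q ! 0) (q ! 1) i j < p) \<longleftrightarrow> occ X 0 1 i j < p \<or> occ X 1 0 i j < p"
    for X i j by (simp add: I2_def disj_commute)
  moreover have "distinct I2" "\<And>q. q \<in> set I2 \<Longrightarrow> length q = 2" by (auto simp: I2_def)
  ultimately show ?thesis by (simp only: forb_copies[of I2 2] avoiding_two)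
qed

lemma forb_K2:
  "forb m 3 2 (copies p K2) = Max (card ` {X. X \<subseteq> cols m \<and>
     (\<forall>i<m. \<forall>j<m. i \<noteq> j \<longrightarrow> (\<exists>a<2. \<exists>b<2. occ X a b i j < p))})"
proof -
  have ex2: "(\<exists>a<2. Q a) \<longleftrightarrow> Q 0 \<or> Q (1::nat)" for Q using less_2_cases_iff by auto
  have "(\<exists>q\<in>set K2. occ X (q ! 0) (q ! 1) i j < p) \<longleftrightarrow> (\<exists>a<2. \<exists>b<2. occ X a b i j < p)"
    for X i j by (simp add: K2_def ex2)
  moreover have "distinct K2" "\<And>q. q \<in> set K2 \<Longrightarrow> length q = 2" by (auto simp: K2_def)
  ultimately show ?thesis by (simp only: forb_copies[of K2 2] avoiding_two)
qed

section \<open>Columns respecting a choice of missing patterns\<close>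

text \<open>The absent 0-1 pattern may vary from pair to pair. This weak form covers the missing
  patterns of K_2 as well as the orientations of I_2, so one bound serves both.\<close>

definition misses :: "(nat \<Rightarrow> nat) set \<Rightarrow> nat \<Rightarrow> nat \<Rightarrow> bool" where
  "misses X i j \<longleftrightarrow> (\<exists>a<2. \<exists>b<2. \<forall>c\<in>X. \<not> (c i = a \<and> c j = b))"

text \<open>Columns are sorted by their entry in row \<open>x\<close>; \<open>X0\<close> unites the
  rests belonging to 0 and 1, \<open>X1\<close> holds those belonging to 2. The union undercounts
  only by the rests that occur with both 0 and 1, and such a rest avoids a fixed 0-1 entry in each
  row of \<open>R\<close>, which leaves two values per row.\<close>

lemma delete_row:
  assumes R: "finite R" "x \<notin> R" and X: "X \<subseteq> insert x R \<rightarrow>\<^sub>E {..<3}"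
    and misses: "\<And>i. i \<in> R \<Longrightarrow> misses X x i"
  obtains X0 X1 where "X0 \<subseteq> R \<rightarrow>\<^sub>E {..<3}" "X1 \<subseteq> R \<rightarrow>\<^sub>E {..<3}"
    "\<And>y. y \<in> X0 \<union> X1 \<Longrightarrow> \<exists>c\<in>X. \<forall>i\<in>R. y i = c i"
    "card X \<le> card X0 + card X1 + 2 ^ card R"
proof -
  define Y where "Y v = {y \<in> R \<rightarrow>\<^sub>E {..<3}. y(x := v) \<in> X}" for v :: nat
  have fin: "finite (R \<rightarrow>\<^sub>E {..<3::nat})" using R by (intro finite_PiE) auto
  have finY: "finite (Y v)" for v unfolding Y_def using fin by simp
  have "X \<subseteq> (\<Union>v\<in>{..<3}. (\<lambda>y. y(x := v)) ` Y v)"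
  proof
    fix c assume c: "c \<in> X"
    then have cP: "c \<in> insert x R \<rightarrow>\<^sub>E {..<3}" using X by blast
    have "c(x := undefined) \<in> R \<rightarrow>\<^sub>E {..<3}" using R(2) cP by (rule fun_upd_in_PiE)
    then have "c(x := undefined) \<in> Y (c x)" using c by (simp add: Y_def)
    moreover have "c = (c(x := undefined))(x := c x)" by simp
    moreover have "c x \<in> {..<3}" using cP by (rule PiE_mem) simp
    ultimately show "c \<in> (\<Union>v\<in>{..<3}. (\<lambda>y. y(x := v)) ` Y v)" by blast
  qed
  then have "card X \<le> card (\<Union>v\<in>{..<3}. (\<lambda>y. y(x := v)) ` Y v)"
    using finY by (intro card_mono) auto
  also have "\<dots> \<le> (\<Sum>v<3. card ((\<lambda>y. y(x := v)) ` Y v))" by (rule card_UN_le) simp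
  also have "\<dots> \<le> (\<Sum>v<3. card (Y v))" by (intro sum_mono card_image_le finY)
  also have "\<dots> = card (Y 0) + card (Y 1) + card (Y 2)" by (simp add: numeral_3_eq_3 numeral_2_eq_2)
  also have "card (Y 0) + card (Y 1) = card (Y 0 \<union> Y 1) + card (Y 0 \<inter> Y 1)"
    by (intro card_Un_Int finY)
  finally have 1: "card X \<le> card (Y 0 \<union> Y 1) + card (Y 2) + card (Y 0 \<inter> Y 1)" by simp
  have "\<forall>i. \<exists>b<2. i \<in> R \<longrightarrow> (\<exists>a<2. \<forall>c\<in>X. \<not> (c x = a \<and> c i = b))"
    using misses unfolding misses_def by (metis pos2)
  from choice[OF this] obtain b where b: "\<And>i. b i < 2"
    "\<And>i. i \<in> R \<Longrightarrow> \<exists>a<2. \<forall>c\<in>X. \<not> (c x = a \<and> c i = b i)" by blast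
  have "Y 0 \<inter> Y 1 \<subseteq> (\<Pi>\<^sub>E i\<in>R. {..<3} - {b i})"
  proof
    fix y assume y: "y \<in> Y 0 \<inter> Y 1"
    then have yP: "y \<in> R \<rightarrow>\<^sub>E {..<3}" by (simp add: Y_def)
    have "y i \<in> {..<3} - {b i}" if i: "i \<in> R" for i
    proof -
      obtain a where a: "a < 2" "\<And>c. c \<in> X \<Longrightarrow> \<not> (c x = a \<and> c i = b i)" using b(2)[OF i] by blast
      \<comment> \<open>Both extensions of \<open>y\<close> lie in \<open>X\<close>, in particular
        the one by the \<open>a\<close> of the missing pattern, so \<open>y\<close> cannot show
        \<open>b i\<close> in row \<open>i\<close>.\<close>
      have "y(x := a) \<in> X" using a(1) y by (auto simp: Y_def less_2_cases_iff)
      moreover have "i \<noteq> x" using i R(2) by blast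
      ultimately have "y i \<noteq> b i" using a(2)[of "y(x := a)"] by auto
      then show ?thesis using PiE_mem[OF yP i] by simp
    qed
    then show "y \<in> (\<Pi>\<^sub>E i\<in>R. {..<3} - {b i})" using yP by (simp add: PiE_def)
  qed
  then have "card (Y 0 \<inter> Y 1) \<le> card (\<Pi>\<^sub>E i\<in>R. {..<3} - {b i})"
    using R by (intro card_mono finite_PiE) auto
  also have "\<dots> = (\<Prod>i\<in>R. card ({..<3} - {b i}))" using R by (simp add: card_PiE)
  also have "\<dots> = (\<Prod>i\<in>R. 2)"
    using b(1) by (intro prod.cong refl) (simp add: card_Diff_singleton less_trans[of _ 2 3])
  finally have 2: "card (Y 0 \<inter> Y 1) \<le> 2 ^ card R" by simp
  have "\<exists>c\<in>X. \<forall>i\<in>R. y i = c i" if y: "y \<in> (Y 0 \<union> Y 1) \<union> Y 2" for y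
  proof -
    obtain v where "y(x := v) \<in> X" using y by (auto simp: Y_def)
    moreover have "\<forall>i\<in>R. y i = (y(x := v)) i" using R(2) by auto
    ultimately show ?thesis by blast
  qed
  moreover have "Y 0 \<union> Y 1 \<subseteq> R \<rightarrow>\<^sub>E {..<3}" "Y 2 \<subseteq> R \<rightarrow>\<^sub>E {..<3}" by (auto simp: Y_def)
  moreover have "card X \<le> card (Y 0 \<union> Y 1) + card (Y 2) + 2 ^ card R" using 1 2 by simp
  ultimately show thesis using that by blast
qed

lemma misses_restrict:
  assumes "misses X i j" "\<And>y. y \<in> Y \<Longrightarrow> \<exists>c\<in>X. \<forall>i\<in>R. y i = c i" "i \<in> R" "j \<in> R"
  shows "misses Y i j"
  using assms unfolding misses_def by metis

text \<open>Induction with \<open>delete_row\<close>; the bound is stated in doubled form because (n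
  + 2) 2^(n - 1) has a negative exponent at n = 0.\<close>

lemma card_le_of_misses:
  assumes "finite R" "X \<subseteq> R \<rightarrow>\<^sub>E {..<3}"
    and "\<And>i j. i \<in> R \<Longrightarrow> j \<in> R \<Longrightarrow> i \<noteq> j \<Longrightarrow> misses X i j"
  shows "2 * card X \<le> (card R + 2) * 2 ^ card R"
  using assms
proof (induction R arbitrary: X rule: finite_induct)
  case empty
  then have "card X \<le> card {\<lambda>_ :: nat. undefined :: nat}" by (intro card_mono) auto
  then show ?case by simp
next
  case (insert x R)
  have "misses X x i" if "i \<in> R" for i using insert.prems(2)[of x i] insert.hyps that by auto
  from delete_row[OF insert.hyps insert.prems(1) this]
  obtain X0 X1 where X: "X0 \<subseteq> R \<rightarrow>\<^sub>E {..<3}" "X1 \<subseteq> R \<rightarrow>\<^sub>E {..<3}"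
    and e: "\<And>y. y \<in> X0 \<union> X1 \<Longrightarrow> \<exists>c\<in>X. \<forall>i\<in>R. y i = c i"
    and c: "card X \<le> card X0 + card X1 + 2 ^ card R" by blast
  have m: "misses X0 i j" "misses X1 i j" if "i \<in> R" "j \<in> R" "i \<noteq> j" for i j
    using that e insert.prems(2)[of i j] by (auto intro!: misses_restrict[of X i j _ R])
  show ?case
    using insert.IH[OF X(1) m(1)] insert.IH[OF X(2) m(2)] c insert.hyps by (simp add: algebra_simps)
qed

text \<open>Three cyclically oriented rows admit 18 columns instead of the 20 allowed by
  \<open>card_le_of_misses\<close>; the loss of 2 doubles with every further row.\<close>

lemma card_le_of_misses_cyclic:
  assumes "finite S" "u \<notin> S" "v \<notin> S" "w \<notin> S" "distinct [u, v, w]"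
    and "X \<subseteq> {u, v, w} \<union> S \<rightarrow>\<^sub>E {..<3}"
    and "\<And>i j. i \<in> {u, v, w} \<union> S \<Longrightarrow> j \<in> {u, v, w} \<union> S \<Longrightarrow> i \<noteq> j \<Longrightarrow> misses X i j"
    and "\<And>c. c \<in> X \<Longrightarrow> \<not> (c u = 0 \<and> c v = 1) \<and> \<not> (c v = 0 \<and> c w = 1) \<and> \<not> (c w = 0 \<and> c u = 1)"
  shows "4 * card X \<le> (2 * card S + 9) * 2 ^ (card S + 3)"
  using assms
proof (induction S arbitrary: X rule: finite_induct)
  case empty
  \<comment> \<open>Of the 27 triples, 18 have no 0 followed cyclically by a 1, and 4 * 18 = 9 * 2^3
    is the claimed bound for empty \<open>S\<close>.\<close>
  let ?ok = "\<lambda>(a, b, c). \<not> (a = 0 \<and> b = 1) \<and> \<not> (b = 0 \<and> c = 1) \<and> \<not> (c = 0 \<and> a = (1::nat))"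
  let ?l = "[0::nat, 1, 2]"
  let ?L = "filter ?ok (List.product ?l (List.product ?l ?l))"
  let ?f = "\<lambda>c. (c u, c v, c w)"
  have XP: "X \<subseteq> {u, v, w} \<rightarrow>\<^sub>E {..<3}" using empty by simp
  have "inj_on ?f X"
  proof (rule inj_onI)
    fix c d assume cd: "c \<in> X" "d \<in> X" "?f c = ?f d"
    then have "c \<in> {u, v, w} \<rightarrow>\<^sub>E {..<3}" "d \<in> {u, v, w} \<rightarrow>\<^sub>E {..<3}" using XP by blast+
    then show "c = d" by (rule PiE_ext) (use cd(3) in auto)
  qed
  moreover have "?f ` X \<subseteq> set ?L"
  proof
    fix z assume "z \<in> ?f ` X"
    then obtain c where c: "c \<in> X" "z = ?f c" by blast
    have lt: "n \<in> set ?l" if "n < 3" for n using that by auto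
    have "c \<in> {u, v, w} \<rightarrow>\<^sub>E {..<3}" using XP c(1) by blast
    then have "c i < 3" if "i \<in> {u, v, w}" for i using that by (auto dest: PiE_mem)
    then have "c u \<in> set ?l" "c v \<in> set ?l" "c w \<in> set ?l"
      by (rule lt, blast)+
    then have "z \<in> set (List.product ?l (List.product ?l ?l))"
      by (simp only: c(2) set_product mem_Sigma_iff simp_thms)
    moreover have "?ok z" using empty.prems(7)[OF c(1)] by (simp add: c(2))
    ultimately show "z \<in> set ?L" by (simp only: set_filter mem_Collect_eq simp_thms)
  qed
  ultimately have "card X \<le> card (set ?L)" by (rule card_inj_on_le) simp
  also have "\<dots> \<le> length ?L" by (rule card_length)
  also have "length ?L = 18" by simp
  finally show ?case by simp
next
  case (insert x S)
  let ?R = "{u, v, w} \<union> S"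
  have R: "finite ?R" "x \<notin> ?R" and eq: "{u, v, w} \<union> insert x S = insert x ?R"
    using insert by auto
  have XP: "X \<subseteq> insert x ?R \<rightarrow>\<^sub>E {..<3}" using insert.prems(5) unfolding eq .
  have mX: "misses X i j" if "i \<in> insert x ?R" "j \<in> insert x ?R" "i \<noteq> j" for i j
    using insert.prems(6)[unfolded eq] that by blast
  have "misses X x i" if "i \<in> ?R" for i using mX[of x i] that R(2) by blast
  from delete_row[OF R XP this]
  obtain X0 X1 where X: "X0 \<subseteq> ?R \<rightarrow>\<^sub>E {..<3}" "X1 \<subseteq> ?R \<rightarrow>\<^sub>E {..<3}"
    and e: "\<And>y. y \<in> X0 \<union> X1 \<Longrightarrow> \<exists>c\<in>X. \<forall>i\<in>?R. y i = c i"
    and c: "card X \<le> card X0 + card X1 + 2 ^ card ?R" by blast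
  have e0: "\<And>y. y \<in> X0 \<Longrightarrow> \<exists>c\<in>X. \<forall>i\<in>?R. y i = c i" and e1: "\<And>y. y \<in> X1 \<Longrightarrow> \<exists>c\<in>X. \<forall>i\<in>?R. y i = c i"
    using e by blast+
  have m: "misses X0 i j" "misses X1 i j" if ij: "i \<in> ?R" "j \<in> ?R" "i \<noteq> j" for i j
    using misses_restrict[OF mX e0, of i j] misses_restrict[OF mX e1, of i j] ij by blast+
  have cyc: "\<not> (c u = 0 \<and> c v = 1) \<and> \<not> (c v = 0 \<and> c w = 1) \<and> \<not> (c w = 0 \<and> c u = 1)"
    if c01: "c \<in> X0 \<union> X1" for c
  proof -
    obtain d where d: "d \<in> X" "\<forall>i\<in>?R. c i = d i" using e[OF c01] by blast
    then have "c u = d u" "c v = d v" "c w = d w" by auto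
    then show ?thesis using insert.prems(7)[OF d(1)] by simp
  qed
  have nS: "u \<notin> S" "v \<notin> S" "w \<notin> S" using insert.prems by auto
  have cR: "card ?R = card S + 3" using insert.hyps(1) nS insert.prems(4) by simp
  have "4 * card X0 \<le> (2 * card S + 9) * 2 ^ (card S + 3)"
    by (rule insert.IH[OF nS insert.prems(4) X(1)]) (use m(1) cyc in blast)+
  moreover have "4 * card X1 \<le> (2 * card S + 9) * 2 ^ (card S + 3)"
    by (rule insert.IH[OF nS insert.prems(4) X(2)]) (use m(2) cyc in blast)+
  ultimately have "4 * card X \<le> 2 * ((2 * card S + 9) * 2 ^ (card S + 3)) + 4 * 2 ^ (card S + 3)"
    using c[unfolded cR] by linarith
  also have "\<dots> = (2 * card (insert x S) + 9) * 2 ^ (card (insert x S) + 3)"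
    using insert.hyps by (simp add: algebra_simps power_add)
  finally show ?case .
qed

section \<open>Building large families and charging columns to pairs\<close>

lemma cols_upd: "c \<in> cols m \<Longrightarrow> v < 3 \<Longrightarrow> c(m := v) \<in> cols (Suc m)"
  unfolding cols_def lessThan_Suc by (rule PiE_fun_upd) auto

lemma inj_on_upd_cols: "inj_on (\<lambda>c. c(m := v)) (cols m)"
proof (rule inj_onI)
  fix c d assume cd: "c \<in> cols m" "d \<in> cols m" "c(m := v) = d(m := v)"
  then have "c m = d m" by (auto simp: cols_def PiE_def extensional_def)
  then show "c = d" using cd(3) by (metis fun_upd_triv fun_upd_upd)
qed

text \<open>The recursion of the upper bound from the other side: last entries 0 and 2 extend every
  member, and last entry 1 goes under each of the 2^m columns over \<open>W\<close>.
  \<open>W\<close> consists of the two entries that may stand above a 1: {0, 2} for at most one 1,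
  {1, 2} for all 1s above all 0s.\<close>

lemma card_ge_of_extensions:
  assumes G: "\<And>m. G m \<subseteq> cols m" and G0: "(\<lambda>_. undefined) \<in> G 0"
    and ext: "\<And>m c v. c \<in> G m \<Longrightarrow> v \<in> {0, 2} \<Longrightarrow> c(m := v) \<in> G (Suc m)"
    and ext1: "\<And>m c. c \<in> {..<m} \<rightarrow>\<^sub>E W \<Longrightarrow> c(m := 1) \<in> G (Suc m)"
    and W: "W \<subseteq> {..<3}" "card W = 2"
  shows "(m + 2) * 2 ^ m \<le> 2 * card (G m)"
proof (induction m)
  case 0
  have "card {\<lambda>_ :: nat. undefined :: nat} \<le> card (G 0)"
    using G0 finite_subset[OF G[of 0]] by (intro card_mono) auto
  then show ?case by simp
next
  case (Suc m)
  let ?u = "\<lambda>v c. (c :: nat \<Rightarrow> nat)(m := v)" and ?W = "{..<m} \<rightarrow>\<^sub>E W"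
  have WC: "?W \<subseteq> cols m" unfolding cols_def using W(1) by (intro PiE_mono) auto
  have fin: "finite (G m)" "finite ?W"
    using finite_subset[OF G] finite_subset[OF WC] by auto
  have cU: "card (?u v ` A) = card A" if "A \<subseteq> cols m" for v A
    using inj_on_subset[OF inj_on_upd_cols that] by (rule card_image)
  have disj: "?u v ` A \<inter> ?u v' ` B = {}" if "v \<noteq> v'" for v v' A B
  proof -
    have "?u v c \<noteq> ?u v' d" for c d using that by (metis fun_upd_same)
    then show ?thesis by blast
  qed
  have "card (?u 0 ` G m \<union> ?u 2 ` G m \<union> ?u 1 ` ?W)
      = card (?u 0 ` G m \<union> ?u 2 ` G m) + card (?u 1 ` ?W)"
    using fin disj[of 0 1] disj[of 2 1] by (intro card_Un_disjoint) (auto simp: Int_Un_distrib2)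
  also have "card (?u 0 ` G m \<union> ?u 2 ` G m) = card (?u 0 ` G m) + card (?u 2 ` G m)"
    using fin disj[of 0 2] by (intro card_Un_disjoint) auto
  also have "\<dots> + card (?u 1 ` ?W) = 2 * card (G m) + 2 ^ m"
    by (simp only: cU[OF G] cU[OF WC]) (simp add: card_PiE W(2))
  finally have "2 * card (G m) + 2 ^ m = card (?u 0 ` G m \<union> ?u 2 ` G m \<union> ?u 1 ` ?W)" by (rule sym)
  also have "\<dots> \<le> card (G (Suc m))"
    using ext ext1 finite_subset[OF G] by (intro card_mono) auto
  finally show ?case using Suc by simp
qed

text \<open>Every column outside the remainder violates some \<pi> in \<open>Q\<close> and is
  charged to it; each \<pi> is charged at most \<open>q\<close> times.\<close>

lemma card_le_remove:
  assumes "finite X" "finite Q" "\<And>\<pi>. \<pi> \<in> Q \<Longrightarrow> card {c \<in> X. V \<pi> c} \<le> q"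
  shows "card X \<le> q * card Q + card {c \<in> X. \<forall>\<pi>\<in>Q. \<not> V \<pi> c}"
proof -
  have "X = (\<Union>\<pi>\<in>Q. {c \<in> X. V \<pi> c}) \<union> {c \<in> X. \<forall>\<pi>\<in>Q. \<not> V \<pi> c}" by blast
  then have "card X = card ((\<Union>\<pi>\<in>Q. {c \<in> X. V \<pi> c}) \<union> {c \<in> X. \<forall>\<pi>\<in>Q. \<not> V \<pi> c})"
    by (rule arg_cong)
  also have "\<dots> \<le> card (\<Union>\<pi>\<in>Q. {c \<in> X. V \<pi> c}) + card {c \<in> X. \<forall>\<pi>\<in>Q. \<not> V \<pi> c}"
    by (rule card_Un_le)
  also have "card (\<Union>\<pi>\<in>Q. {c \<in> X. V \<pi> c}) \<le> (\<Sum>\<pi>\<in>Q. card {c \<in> X. V \<pi> c})"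
    using assms(2) by (rule card_UN_le)
  also have "\<dots> \<le> card Q * q" using sum_bounded_above[OF assms(3), of Q] by simp
  finally show ?thesis by (simp add: mult.commute)
qed

text \<open>The columns of \<open>U \<pi>\<close> are private to \<pi>: they violate nothing else in
  \<open>Q\<close>. So \<open>q\<close> of them can be added for every \<pi> in \<open>Pr\<close>
  without touching another quota, and the added sets are disjoint from each other and from
  \<open>Y\<close>.\<close>

lemma saturate:
  fixes V :: "'p \<Rightarrow> 'c \<Rightarrow> bool"
  assumes fin: "finite Y" "finite Pr" and sub: "Pr \<subseteq> Q"
    and U: "\<And>\<pi>. \<pi> \<in> Pr \<Longrightarrow> finite (U \<pi>) \<and> q \<le> card (U \<pi>)"
    and only: "\<And>\<pi> \<rho> c. \<pi> \<in> Pr \<Longrightarrow> \<rho> \<in> Q \<Longrightarrow> c \<in> U \<pi> \<Longrightarrow> V \<rho> c \<longleftrightarrow> \<rho> = \<pi>"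
    and YPr: "\<And>\<pi> c. c \<in> Y \<Longrightarrow> \<pi> \<in> Pr \<Longrightarrow> \<not> V \<pi> c"
    and Yq: "\<And>\<pi>. \<pi> \<in> Q \<Longrightarrow> card {c \<in> Y. V \<pi> c} \<le> q"
  shows "\<exists>X. X \<subseteq> Y \<union> (\<Union>\<pi>\<in>Pr. U \<pi>) \<and> card X = card Y + q * card Pr \<and>
    (\<forall>\<pi>\<in>Q. card {c \<in> X. V \<pi> c} \<le> q)"
proof -
  have "\<forall>\<pi>. \<exists>T. \<pi> \<in> Pr \<longrightarrow> T \<subseteq> U \<pi> \<and> card T = q \<and> finite T"
    using U obtain_subset_with_card_n by metis
  from choice[OF this] obtain T where T: "\<And>\<pi>. \<pi> \<in> Pr \<Longrightarrow> T \<pi> \<subseteq> U \<pi>"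
    "\<And>\<pi>. \<pi> \<in> Pr \<Longrightarrow> card (T \<pi>) = q" "\<And>\<pi>. \<pi> \<in> Pr \<Longrightarrow> finite (T \<pi>)" by blast
  have V: "V \<rho> c \<longleftrightarrow> \<rho> = \<pi>" if "\<pi> \<in> Pr" "\<rho> \<in> Q" "c \<in> T \<pi>" for \<pi> \<rho> c
    using only[OF that(1,2)] T(1) that by blast
  define X where "X = Y \<union> (\<Union>\<pi>\<in>Pr. T \<pi>)"
  have "Y \<inter> (\<Union>\<pi>\<in>Pr. T \<pi>) = {}" using YPr V sub by blast
  then have "card X = card Y + card (\<Union>\<pi>\<in>Pr. T \<pi>)"
    unfolding X_def using fin T(3) by (intro card_Un_disjoint) auto
  also have "card (\<Union>\<pi>\<in>Pr. T \<pi>) = (\<Sum>\<pi>\<in>Pr. card (T \<pi>))"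
  proof (intro card_UN_disjoint fin ballI impI)
    fix \<pi> \<rho> assume "\<pi> \<in> Pr" "\<rho> \<in> Pr" "\<pi> \<noteq> \<rho>"
    then show "T \<pi> \<inter> T \<rho> = {}" using V[of \<pi> \<rho>] V[of \<rho> \<rho>] sub by blast
  qed (use T(3) in blast)
  also have "\<dots> = q * card Pr" using T(2) by simp
  finally have "card X = card Y + q * card Pr" .
  moreover have "card {c \<in> X. V \<pi> c} \<le> q" if \<pi>: "\<pi> \<in> Q" for \<pi>
  proof (cases "\<pi> \<in> Pr")
    case True
    then have "{c \<in> X. V \<pi> c} \<subseteq> T \<pi>" using V \<pi> YPr unfolding X_def by blast
    then show ?thesis using T(2,3)[OF True] card_mono by metis
  next
    case False
    then have "{c \<in> X. V \<pi> c} = {c \<in> Y. V \<pi> c}" using V \<pi> unfolding X_def by blast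
    then show ?thesis using Yq[OF \<pi>] by simp
  qed
  moreover have "X \<subseteq> Y \<union> (\<Union>\<pi>\<in>Pr. U \<pi>)" using T(1) unfolding X_def by blast
  ultimately show ?thesis by blast
qed

lemma card_PiE_two_one:
  assumes "finite R" "\<And>k. k \<in> R \<Longrightarrow> k \<in> D \<Longrightarrow> card (W k) = 2" "\<And>k. k \<in> R \<Longrightarrow> k \<notin> D \<Longrightarrow> card (W k) = 1"
  shows "card (\<Pi>\<^sub>E k\<in>R. W k) = 2 ^ card (R \<inter> D)"
proof -
  have "card (\<Pi>\<^sub>E k\<in>R. W k) = (\<Prod>k\<in>R. if k \<in> D then 2 else 1)"
    using assms by (subst card_PiE) (auto intro!: prod.cong)
  also have "\<dots> = 2 ^ card (R \<inter> D)"
    using assms(1) by (simp add: prod.If_cases)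
  finally show ?thesis .
qed

section \<open>The two extremal numbers\<close>

definition pairs :: "nat \<Rightarrow> (nat \<times> nat) set" where
  "pairs m = {(i, j). i < j \<and> j < m}"

lemma finite_pairs [simp]: "finite (pairs m)"
  by (rule finite_subset[of _ "{..<m} \<times> {..<m}"]) (auto simp: pairs_def)

lemma misses_sym: "misses X i j \<Longrightarrow> misses X j i"
  unfolding misses_def by blast

lemma misses_of_pairs:
  assumes "\<And>\<pi>. \<pi> \<in> pairs m \<Longrightarrow> misses X (fst \<pi>) (snd \<pi>)" "i < m" "j < m" "i \<noteq> j"
  shows "misses X i j"
proof (cases "i < j")
  case True
  then show ?thesis using assms(1)[of "(i, j)"] assms(3) by (simp add: pairs_def)
next
  case False
  then have "misses X j i" using assms(1)[of "(j, i)"] assms(2,4) by (simp add: pairs_def)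
  then show ?thesis by (rule misses_sym)
qed

lemma card_le_of_misses_cols:
  assumes "X \<subseteq> cols m" "\<And>\<pi>. \<pi> \<in> pairs m \<Longrightarrow> misses X (fst \<pi>) (snd \<pi>)"
  shows "2 * card X \<le> (m + 2) * 2 ^ m"
proof -
  have "2 * card X \<le> (card {..<m} + 2) * 2 ^ card {..<m}"
    using assms misses_of_pairs[OF assms(2)]
    by (intro card_le_of_misses) (auto simp: cols_def)
  then show ?thesis by simp
qed

lemma occ_sym: "occ X a b i j = occ X b a j i"
  by (simp add: occ_def conj_commute)

lemma finite_cols_subset: "X \<subseteq> cols m \<Longrightarrow> finite X"
  by (rule finite_subset[OF _ finite_cols])

lemma Max_card_le:
  assumes "\<And>X. P X \<Longrightarrow> X \<subseteq> cols m" "P X0" "\<And>X. P X \<Longrightarrow> k * card X \<le> n"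
  shows "k * Max (card ` {X. P X}) \<le> n"
proof -
  have "finite {X. P X}" by (rule finite_subset[of _ "Pow (cols m)"]) (use assms(1) in auto)
  then have "Max (card ` {X. P X}) \<in> card ` {X. P X}" using assms(2) by (intro Max_in) auto
  then show ?thesis using assms(3) by auto
qed

lemma card_le_Max:
  assumes "\<And>X. P X \<Longrightarrow> X \<subseteq> cols m" "P X"
  shows "card X \<le> Max (card ` {X. P X})"
proof -
  have "finite {X. P X}" by (rule finite_subset[of _ "Pow (cols m)"]) (use assms(1) in auto)
  then show ?thesis using assms(2) by (intro Max_ge) auto
qed

text \<open>The condition on \<open>q\<close> says that every pair has enough private columns: those
  with 1 exactly in the two rows and 0 or 2 elsewhere, 2^(m - 2) in number.\<close>

lemma forb_K2_eq:
  assumes "q \<le> 2 ^ (m - 2)"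
  shows "2 * forb m 3 2 (copies (Suc q) K2) = (m + 2) * 2 ^ m + 2 * (q * card (pairs m))"
proof (rule antisym)
  let ?P = "\<lambda>X. X \<subseteq> cols m \<and> (\<forall>i<m. \<forall>j<m. i \<noteq> j \<longrightarrow> (\<exists>a<2. \<exists>b<2. occ X a b i j < Suc q))"
  show "2 * forb m 3 2 (copies (Suc q) K2) \<le> (m + 2) * 2 ^ m + 2 * (q * card (pairs m))"
    unfolding forb_K2
  proof (rule Max_card_le[where m = m])
    have "occ {} 0 0 i j < Suc q" for i j by (simp add: occ_def)
    then show "?P {}" by (metis empty_subsetI pos2)
  next
    fix X assume X: "?P X"
    have "\<forall>\<pi>. \<exists>ab. \<pi> \<in> pairs m \<longrightarrow> fst ab < 2 \<and> snd ab < 2 \<and> occ X (fst ab) (snd ab) (fst \<pi>) (snd \<pi>) \<le> q"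
    proof
      fix \<pi>
      show "\<exists>ab. \<pi> \<in> pairs m \<longrightarrow> fst ab < 2 \<and> snd ab < 2 \<and> occ X (fst ab) (snd ab) (fst \<pi>) (snd \<pi>) \<le> q"
      proof (cases "\<pi> \<in> pairs m")
        case True
        then have "fst \<pi> < m" "snd \<pi> < m" "fst \<pi> \<noteq> snd \<pi>" by (auto simp: pairs_def)
        then obtain a b where "a < 2" "b < 2" "occ X a b (fst \<pi>) (snd \<pi>) < Suc q" using X by blast
        then show ?thesis by (intro exI[of _ "(a, b)"]) simp
      qed simp
    qed
    from choice[OF this] obtain ab where ab: "\<And>\<pi>. \<pi> \<in> pairs m \<Longrightarrow>
      fst (ab \<pi>) < 2 \<and> snd (ab \<pi>) < 2 \<and> occ X (fst (ab \<pi>)) (snd (ab \<pi>)) (fst \<pi>) (snd \<pi>) \<le> q" by blast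
    let ?V = "\<lambda>\<pi> c. c (fst \<pi>) = fst (ab \<pi>) \<and> c (snd \<pi>) = snd (ab \<pi>)"
    let ?Z = "{c \<in> X. \<forall>\<pi>\<in>pairs m. \<not> ?V \<pi> c}"
    have "card X \<le> q * card (pairs m) + card ?Z"
      using X ab by (intro card_le_remove) (auto simp: occ_def intro: finite_cols_subset)
    moreover have "2 * card ?Z \<le> (m + 2) * 2 ^ m"
    proof (rule card_le_of_misses_cols)
      fix \<pi> assume \<pi>: "\<pi> \<in> pairs m"
      then have "\<forall>c\<in>?Z. \<not> ?V \<pi> c" by blast
      then show "misses ?Z (fst \<pi>) (snd \<pi>)" unfolding misses_def using ab[OF \<pi>] by blast
    qed (use X in blast)
    ultimately show "2 * card X \<le> (m + 2) * 2 ^ m + 2 * (q * card (pairs m))" by linarith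
  qed simp
  let ?V = "\<lambda>\<pi> c. c (fst \<pi>) = (1::nat) \<and> c (snd \<pi>) = (1::nat)"
  let ?G = "\<lambda>m. {c \<in> cols m. \<forall>i<m. \<forall>j<m. i \<noteq> j \<longrightarrow> \<not> (c i = 1 \<and> c j = 1)}"
  have G: "(m + 2) * 2 ^ m \<le> 2 * card (?G m)"
  proof (rule card_ge_of_extensions[where W = "{0, 2}"])
    fix m c v assume "c \<in> ?G m" "v \<in> {0, 2::nat}"
    then show "c(m := v) \<in> ?G (Suc m)" by (auto simp: less_Suc_eq intro!: cols_upd)
  next
    fix m and c :: "nat \<Rightarrow> nat" assume c: "c \<in> {..<m} \<rightarrow>\<^sub>E {0, 2}"
    then have "c \<in> cols m" unfolding cols_def by (rule PiE_mono[THEN subsetD, rotated]) auto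
    moreover have "c i \<noteq> 1" if "i < m" for i using PiE_mem[OF c, of i] that by auto
    ultimately show "c(m := 1) \<in> ?G (Suc m)" by (auto simp: less_Suc_eq intro!: cols_upd)
  qed (auto simp: cols_def)
  let ?W = "\<lambda>\<pi> k. if k = fst \<pi> \<or> k = snd \<pi> then {1} else {0, 2::nat}"
  let ?U = "\<lambda>\<pi> :: nat \<times> nat. \<Pi>\<^sub>E k\<in>{..<m}. ?W \<pi> k"
  have UC: "?U \<pi> \<subseteq> cols m" for \<pi> unfolding cols_def by (intro PiE_mono) auto
  have Um: "c k \<in> ?W \<pi> k" if "c \<in> ?U \<pi>" "k < m" for c \<pi> k using PiE_mem[OF that(1), of k] that(2) by simp
  have GV: "\<not> ?V \<pi> c" if "c \<in> ?G m" "\<pi> \<in> pairs m" for \<pi> c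
  proof -
    have "fst \<pi> < m" "snd \<pi> < m" "fst \<pi> \<noteq> snd \<pi>" using that(2) by (auto simp: pairs_def)
    then show ?thesis using that(1) by blast
  qed
  have "\<exists>X. X \<subseteq> ?G m \<union> (\<Union>\<pi>\<in>pairs m. ?U \<pi>) \<and> card X = card (?G m) + q * card (pairs m) \<and>
    (\<forall>\<pi>\<in>pairs m. card {c \<in> X. ?V \<pi> c} \<le> q)"
  proof (rule saturate[where Pr = "pairs m" and Q = "pairs m" and U = ?U and V = ?V and Y = "?G m" and q = q])
    fix \<pi> assume \<pi>: "\<pi> \<in> pairs m"
    have "card (?U \<pi>) = 2 ^ card ({..<m} \<inter> (- {fst \<pi>, snd \<pi>}))"
      by (intro card_PiE_two_one) auto
    also have "{..<m} \<inter> (- {fst \<pi>, snd \<pi>}) = {..<m} - {fst \<pi>, snd \<pi>}" by blast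
    also have "card \<dots> = m - 2"
      using \<pi> by (subst card_Diff_subset) (auto simp: pairs_def)
    finally show "finite (?U \<pi>) \<and> q \<le> card (?U \<pi>)"
      using assms finite_cols_subset[OF UC] by simp
  next
    fix \<pi> \<rho> c assume \<pi>: "\<pi> \<in> pairs m" "\<rho> \<in> pairs m" and c: "c \<in> ?U \<pi>"
    have lt: "fst \<pi> < m" "snd \<pi> < m" "fst \<rho> < m" "snd \<rho> < m" "fst \<pi> < snd \<pi>" "fst \<rho> < snd \<rho>"
      using \<pi> by (auto simp: pairs_def)
    have one: "c k = 1 \<longleftrightarrow> k = fst \<pi> \<or> k = snd \<pi>" if "k < m" for k
      using Um[OF c that] by (auto split: if_splits)
    show "?V \<rho> c \<longleftrightarrow> \<rho> = \<pi>"
      unfolding one[OF lt(3)] one[OF lt(4)] prod_eq_iff using lt by linarith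
  next
    fix \<pi> c assume "c \<in> ?G m" "\<pi> \<in> pairs m"
    then show "\<not> ?V \<pi> c" by (rule GV)
  next
    fix \<pi> assume "\<pi> \<in> pairs m"
    then have "{c \<in> ?G m. ?V \<pi> c} = {}" using GV by blast
    then show "card {c \<in> ?G m. ?V \<pi> c} \<le> q" by (simp only: card.empty)
  qed simp_all
  then obtain X where X: "X \<subseteq> ?G m \<union> (\<Union>\<pi>\<in>pairs m. ?U \<pi>)" "card X = card (?G m) + q * card (pairs m)"
    "\<And>\<pi>. \<pi> \<in> pairs m \<Longrightarrow> card {c \<in> X. ?V \<pi> c} \<le> q" by blast
  have "occ X 1 1 i j < Suc q" if "i < m" "j < m" "i \<noteq> j" for i j
  proof (cases "i < j")
    case True
    then show ?thesis using X(3)[of "(i, j)"] that by (simp add: pairs_def occ_def)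
  next
    case False
    then show ?thesis using X(3)[of "(j, i)"] that by (subst occ_sym) (simp add: pairs_def occ_def)
  qed
  moreover have "X \<subseteq> cols m" using X(1) UC by blast
  ultimately have "?P X" by (metis one_less_numeral_iff semiring_norm(76))
  then have "card X \<le> forb m 3 2 (copies (Suc q) K2)"
    unfolding forb_K2 by (rule card_le_Max[where m = m, rotated]) simp
  then show "(m + 2) * 2 ^ m + 2 * (q * card (pairs m)) \<le> 2 * forb m 3 2 (copies (Suc q) K2)"
    using G X(2) by linarith
qed

section \<open>The order with all 1s above all 0s: near and far pairs\<close>

text \<open>A violation of this order, with row 0 on top.\<close>

definition bad :: "nat \<times> nat \<Rightarrow> (nat \<Rightarrow> nat) \<Rightarrow> bool" where
  "bad \<pi> c \<longleftrightarrow> c (fst \<pi>) = 0 \<and> c (snd \<pi>) = 1"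

text \<open>Fewer than \<open>t\<close> rows lie outside the interval spanned by a near pair.\<close>

definition near :: "nat \<Rightarrow> nat \<Rightarrow> (nat \<times> nat) set" where
  "near m t = {(i, j) \<in> pairs m. i + m \<le> j + t}"

text \<open>A column with even one bad pair outside \<open>near m t\<close> is excluded, because it
  can be charged to the quota of that pair. The columns kept can be charged to near pairs
  only.\<close>

definition near_bad :: "nat \<Rightarrow> nat \<Rightarrow> (nat \<Rightarrow> nat) set" where
  "near_bad m t = {c \<in> cols m. (\<exists>\<pi>\<in>pairs m. bad \<pi> c) \<and> (\<forall>\<pi>\<in>pairs m. bad \<pi> c \<longrightarrow> \<pi> \<in> near m t)}"

definition near_families :: "nat \<Rightarrow> nat \<Rightarrow> nat \<Rightarrow> (nat \<Rightarrow> nat) set set" where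
  "near_families m t q = {Y. Y \<subseteq> near_bad m t \<and> (\<forall>\<pi>\<in>pairs m. card {c \<in> Y. bad \<pi> c} \<le> q)}"

definition max_near :: "nat \<Rightarrow> nat \<Rightarrow> nat \<Rightarrow> nat" where
  "max_near m t q = Max (card ` near_families m t q)"

lemma near_subset: "near m t \<subseteq> pairs m"
  by (auto simp: near_def)

lemma finite_near [simp]: "finite (near m t)"
  using near_subset finite_pairs by (rule finite_subset)

lemma near_bad_subset: "near_bad m t \<subseteq> cols m"
  by (auto simp: near_bad_def)

lemma near_families_subset: "Y \<in> near_families m t q \<Longrightarrow> Y \<subseteq> cols m"
  using near_bad_subset by (auto simp: near_families_def)

lemma finite_near_families: "finite (near_families m t q)"
  by (rule finite_subset[of _ "Pow (cols m)"]) (auto dest: near_families_subset)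

lemma card_le_max_near: "Y \<in> near_families m t q \<Longrightarrow> card Y \<le> max_near m t q"
  unfolding max_near_def using finite_near_families by (intro Max_ge) auto

lemma ex_max_near: obtains Y where "Y \<in> near_families m t q" "card Y = max_near m t q"
proof -
  have "{} \<in> near_families m t q" by (simp add: near_families_def)
  then have "max_near m t q \<in> card ` near_families m t q"
    unfolding max_near_def using finite_near_families by (intro Max_in) auto
  then show thesis using that by auto
qed

lemma two_card_near:
  assumes "2 * t \<le> m"
  shows "2 * card (near m t) = t * (t + 1)"
proof -
  \<comment> \<open>Row \<open>i\<close> has the t - i partners from m - t + i on; as 2t <= m, they
    all lie below row \<open>i\<close>.\<close>
  have "near m t = Sigma {..<t} (\<lambda>i. {m - t + i..<m})"
    using assms by (auto simp: near_def pairs_def)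
  then have "card (near m t) = (\<Sum>i<t. card {m - t + i..<m})" by (simp add: card_SigmaI)
  also have "\<dots> = (\<Sum>i<t. t - i)" using assms by (intro sum.cong) auto
  also have "\<dots> = (\<Sum>i<t. Suc (t - Suc i))" by (intro sum.cong) auto
  also have "\<dots> = (\<Sum>i<t. Suc i)" by (rule sum.nat_diff_reindex)
  also have "2 * \<dots> = t * (t + 1)" by (induction t) auto
  finally show ?thesis .
qed

text \<open>At least \<open>r\<close> rows lie outside the interval of a far pair, so
  \<open>q \<le> 2 ^ r\<close> supplies its private columns. An optimal near family violates no far
  pair and can therefore join the good columns before the far pairs are saturated.\<close>

lemma forb_I2_ge:
  assumes "q \<le> 2 ^ r"
  shows "(m + 2) * 2 ^ m + 2 * (q * card (pairs m - near m r) + max_near m r q)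
    \<le> 2 * forb m 3 2 (copies (Suc q) I2)"
proof -
  let ?P = "\<lambda>X. X \<subseteq> cols m \<and> (\<forall>i<m. \<forall>j<m. i \<noteq> j \<longrightarrow> occ X 0 1 i j < Suc q \<or> occ X 1 0 i j < Suc q)"
  let ?G = "\<lambda>m. {c \<in> cols m. \<forall>\<pi>\<in>pairs m. \<not> bad \<pi> c}"
  have G: "(m + 2) * 2 ^ m \<le> 2 * card (?G m)"
  proof (rule card_ge_of_extensions[where W = "{1, 2}"])
    fix m c v assume "c \<in> ?G m" "v \<in> {0, 2::nat}"
    then show "c(m := v) \<in> ?G (Suc m)" by (auto simp: pairs_def bad_def less_Suc_eq intro!: cols_upd)
  next
    fix m and c :: "nat \<Rightarrow> nat" assume c: "c \<in> {..<m} \<rightarrow>\<^sub>E {1, 2}"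
    then have "c \<in> cols m" unfolding cols_def by (rule PiE_mono[THEN subsetD, rotated]) auto
    moreover have "c i \<noteq> 0" if "i < m" for i using PiE_mem[OF c, of i] that by auto
    ultimately show "c(m := 1) \<in> ?G (Suc m)"
      by (auto simp: pairs_def bad_def less_Suc_eq intro!: cols_upd)
  qed (auto simp: cols_def pairs_def)
  obtain Y0 where Y0: "Y0 \<in> near_families m r q" "card Y0 = max_near m r q" by (rule ex_max_near)
  let ?Y = "?G m \<union> Y0"
  have Y0c: "Y0 \<subseteq> cols m" using near_families_subset[OF Y0(1)] .
  have Y0n: "Y0 \<subseteq> near_bad m r" using Y0(1) by (simp add: near_families_def)
  have "?G m \<inter> Y0 = {}" using Y0n by (auto simp: near_bad_def)
  then have cY: "card ?Y = card (?G m) + max_near m r q"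
    using Y0(2) finite_cols_subset[OF Y0c] by (subst card_Un_disjoint) auto
  \<comment> \<open>To make (i, j) the only bad pair: no 0 above i, no 1 below j, and 2 in between,
    where a 0 would be bad with row j and a 1 with row i.\<close>
  let ?W = "\<lambda>\<pi> k. if k < fst \<pi> then {1, 2} else if k = fst \<pi> then {0} else if k < snd \<pi> then {2}
    else if k = snd \<pi> then {1} else {0, 2::nat}"
  let ?U = "\<lambda>\<pi> :: nat \<times> nat. \<Pi>\<^sub>E k\<in>{..<m}. ?W \<pi> k"
  have UC: "?U \<pi> \<subseteq> cols m" for \<pi> unfolding cols_def by (intro PiE_mono) auto
  have Um: "c k \<in> ?W \<pi> k" if "c \<in> ?U \<pi>" "k < m" for c \<pi> k using PiE_mem[OF that(1), of k] that(2) by simp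
  have "\<exists>X. X \<subseteq> ?Y \<union> (\<Union>\<pi>\<in>pairs m - near m r. ?U \<pi>) \<and>
    card X = card ?Y + q * card (pairs m - near m r) \<and> (\<forall>\<pi>\<in>pairs m. card {c \<in> X. bad \<pi> c} \<le> q)"
  proof (rule saturate[where Pr = "pairs m - near m r" and Q = "pairs m" and U = ?U and V = bad
        and Y = ?Y and q = q])
    fix \<pi> assume \<pi>: "\<pi> \<in> pairs m - near m r"
    obtain i j where ij: "\<pi> = (i, j)" by fastforce
    have lt: "i < j" "j < m" "j + r < i + m" using \<pi> by (auto simp: ij near_def pairs_def)
    have "card (?U \<pi>) = 2 ^ card ({..<m} \<inter> ({..<i} \<union> {j<..}))"
      by (intro card_PiE_two_one) (use lt in \<open>auto simp: ij\<close>)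
    also have "{..<m} \<inter> ({..<i} \<union> {j<..}) = {..<i} \<union> {j<..<m}" using lt by auto
    also have "card \<dots> = i + (m - Suc j)" using lt by (subst card_Un_disjoint) auto
    finally have "2 ^ r \<le> card (?U \<pi>)" using lt by (simp add: power_increasing)
    then show "finite (?U \<pi>) \<and> q \<le> card (?U \<pi>)"
      using assms finite_cols_subset[OF UC] by simp
  next
    fix \<pi> \<rho> c assume \<pi>: "\<pi> \<in> pairs m - near m r" "\<rho> \<in> pairs m" and c: "c \<in> ?U \<pi>"
    obtain i j k l where ij: "\<pi> = (i, j)" "\<rho> = (k, l)" by fastforce
    have lt: "i < j" "j < m" "k < l" "l < m" using \<pi> by (auto simp: ij pairs_def)
    show "bad \<rho> c \<longleftrightarrow> \<rho> = \<pi>"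
      using Um[OF c, of k] Um[OF c, of l] lt unfolding ij bad_def
      by (auto split: if_splits)
  next
    fix \<pi> c assume "c \<in> ?Y" "\<pi> \<in> pairs m - near m r"
    then show "\<not> bad \<pi> c" using Y0n by (auto simp: near_bad_def)
  next
    fix \<pi> assume \<pi>: "\<pi> \<in> pairs m"
    then have "{c \<in> ?Y. bad \<pi> c} = {c \<in> Y0. bad \<pi> c}" by auto
    then show "card {c \<in> ?Y. bad \<pi> c} \<le> q" using Y0(1) \<pi> by (simp add: near_families_def)
  qed (use finite_cols_subset[OF Y0c] in simp_all)
  then obtain X where X: "X \<subseteq> ?Y \<union> (\<Union>\<pi>\<in>pairs m - near m r. ?U \<pi>)"
    "card X = card ?Y + q * card (pairs m - near m r)"
    "\<And>\<pi>. \<pi> \<in> pairs m \<Longrightarrow> card {c \<in> X. bad \<pi> c} \<le> q" by blast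
  have lin: "occ X 0 1 i j < Suc q" if "i < j" "j < m" for i j
    using X(3)[of "(i, j)"] that by (simp add: pairs_def occ_def bad_def)
  have "occ X 0 1 i j < Suc q \<or> occ X 1 0 i j < Suc q" if "i < m" "j < m" "i \<noteq> j" for i j
    using lin[of i j] lin[of j i] that unfolding occ_sym[of X 1 0 i j]
    by (cases i j rule: linorder_cases) simp_all
  moreover have "X \<subseteq> cols m" using X(1) UC Y0c by blast
  ultimately have "?P X" by blast
  then have "card X \<le> forb m 3 2 (copies (Suc q) I2)"
    unfolding forb_I2 by (rule card_le_Max[where m = m, rotated]) simp
  then have "card (?G m) + (q * card (pairs m - near m r) + max_near m r q)
    \<le> forb m 3 2 (copies (Suc q) I2)" using X(2) cY by simp
  from mult_le_mono2[OF this, of 2] show ?thesis using G by simp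
qed

text \<open>A column that is bad for some far pair is charged to that pair. What is left is good
  everywhere or lies in \<open>near_bad m r\<close>, and the latter columns form a near family since
  they inherit the quotas of \<open>X\<close>. The bound matches \<open>forb_I2_ge\<close>.\<close>

lemma card_le_of_linear:
  assumes X: "X \<subseteq> cols m" and lin: "\<And>i j. i < j \<Longrightarrow> j < m \<Longrightarrow> occ X 0 1 i j \<le> q"
  shows "2 * card X \<le> (m + 2) * 2 ^ m + 2 * (q * card (pairs m - near m r) + max_near m r q)"
proof -
  have b: "card {c \<in> X. bad \<pi> c} \<le> q" if "\<pi> \<in> pairs m" for \<pi>
    using that lin[of "fst \<pi>" "snd \<pi>"] by (auto simp: pairs_def occ_def bad_def)
  let ?Z = "{c \<in> X. \<forall>\<pi>\<in>pairs m - near m r. \<not> bad \<pi> c}"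
  let ?G = "{c \<in> X. \<forall>\<pi>\<in>pairs m. \<not> bad \<pi> c}"
  let ?N = "{c \<in> X. c \<in> near_bad m r}"
  have fX: "finite X" using X by (rule finite_cols_subset)
  have "card X \<le> q * card (pairs m - near m r) + card ?Z"
    using b fX by (intro card_le_remove) auto
  also have "card ?Z \<le> card (?G \<union> ?N)"
    using X fX by (intro card_mono) (auto simp: near_bad_def)
  also have "card (?G \<union> ?N) \<le> card ?G + card ?N" by (rule card_Un_le)
  also have "card ?N \<le> max_near m r q"
  proof (rule card_le_max_near)
    have "card {c \<in> ?N. bad \<pi> c} \<le> q" if "\<pi> \<in> pairs m" for \<pi>
      using b[OF that] card_mono[of "{c \<in> X. bad \<pi> c}" "{c \<in> ?N. bad \<pi> c}"] fX by fastforce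
    then show "?N \<in> near_families m r q" by (auto simp: near_families_def)
  qed
  finally have "card X \<le> q * card (pairs m - near m r) + (card ?G + max_near m r q)" by simp
  moreover have "2 * card ?G \<le> (m + 2) * 2 ^ m"
  proof (rule card_le_of_misses_cols)
    fix \<pi> assume \<pi>: "\<pi> \<in> pairs m"
    then have "\<forall>c\<in>?G. \<not> (c (fst \<pi>) = 0 \<and> c (snd \<pi>) = 1)" by (auto simp: bad_def)
    then show "misses ?G (fst \<pi>) (snd \<pi>)"
      unfolding misses_def by (intro exI[of _ 0] exI[of _ 1] conjI) auto
  qed (use X in blast)
  ultimately show ?thesis by simp
qed

section \<open>Tournaments of rows and the upper bound for I_2\<close>

text \<open>Arithmetic of the cyclic case, with \<open>t\<close> standing for 2^m: the loss t / 4
  pays for the whole quota \<open>n\<close> of the near pairs, so the bound holds even if they gain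
  nothing.\<close>

lemma double_le_of_cyclic:
  fixes x a n M b z t P :: nat
  assumes "x \<le> P + z" "4 * z + t \<le> 2 * b" "P = a + n" "n * 4 \<le> t"
  shows "2 * x \<le> b + 2 * (a + M)"
proof -
  have "4 * x \<le> 4 * a + 4 * n + 4 * z" using assms(1,3) by simp
  then have "4 * x \<le> 4 * a + 2 * b" using assms(2,4) by simp
  then show ?thesis by simp
qed

text \<open>Rows are ranked by their number of predecessors. Transitivity and irreflexivity make the
  rank strictly increasing along \<open>T\<close>, so it is a permutation of the rows, and its
  inverse is \<sigma>.\<close>

lemma transitive_tournament_sort:
  fixes T :: "nat \<Rightarrow> nat \<Rightarrow> bool"
  assumes tour: "\<And>i j. i < m \<Longrightarrow> j < m \<Longrightarrow> i \<noteq> j \<Longrightarrow> T i j \<longleftrightarrow> \<not> T j i" and irrefl: "\<And>i. \<not> T i i"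
    and trans: "\<And>i j k. i < m \<Longrightarrow> j < m \<Longrightarrow> k < m \<Longrightarrow> T i j \<Longrightarrow> T j k \<Longrightarrow> T i k"
  obtains \<sigma> where "bij_betw \<sigma> {..<m} {..<m}" "\<And>i j. i < j \<Longrightarrow> j < m \<Longrightarrow> T (\<sigma> i) (\<sigma> j)"
proof -
  define rank where "rank i = card {k \<in> {..<m}. T k i}" for i
  have less: "rank i < rank j" if "i < m" "j < m" "T i j" for i j
    unfolding rank_def
  proof (rule psubset_card_mono)
    show "{k \<in> {..<m}. T k i} \<subset> {k \<in> {..<m}. T k j}"
      using that trans irrefl by blast
  qed simp
  have "rank i < m" if "i < m" for i
  proof -
    have "rank i \<le> card ({..<m} - {i})"
      unfolding rank_def using irrefl by (intro card_mono) auto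
    then show ?thesis using that by simp
  qed
  then have sub: "rank ` {..<m} \<subseteq> {..<m}" by blast
  have inj: "inj_on rank {..<m}"
  proof (rule inj_onI)
    fix i j assume "i \<in> {..<m}" "j \<in> {..<m}" "rank i = rank j"
    then show "i = j" using less[of i j] less[of j i] tour[of i j] by fastforce
  qed
  have bij: "bij_betw rank {..<m} {..<m}"
    using endo_inj_surj[OF _ sub inj] inj by (simp add: bij_betw_def)
  let ?\<sigma> = "the_inv_into {..<m} rank"
  have \<sigma>: "bij_betw ?\<sigma> {..<m} {..<m}" using bij by (rule bij_betw_the_inv_into)
  have "T (?\<sigma> i) (?\<sigma> j)" if "i < j" "j < m" for i j
  proof -
    have m: "?\<sigma> i < m" "?\<sigma> j < m" using \<sigma> that by (auto simp: bij_betw_def)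
    have r: "rank (?\<sigma> i) = i" "rank (?\<sigma> j) = j"
      using bij that by (auto intro!: f_the_inv_into_f_bij_betw)
    have "?\<sigma> i \<noteq> ?\<sigma> j"
    proof
      assume "?\<sigma> i = ?\<sigma> j"
      then have "rank (?\<sigma> i) = rank (?\<sigma> j)" by (rule arg_cong)
      then show False using r that(1) by (simp only:)
    qed
    then show ?thesis using tour[OF m] less[OF m(2,1)] r that by fastforce
  qed
  then show thesis using that \<sigma> by blast
qed

text \<open>The rare patterns orient every pair of rows. A transitive orientation reduces to
  \<open>card_le_of_linear\<close> by permuting rows. Any other contains a cyclic triple, whose loss
  of 2^(m - 2) columns is, by the hypothesis, at least the total quota of the near pairs, so it
  cannot beat the linear order.\<close>

lemma forb_I2_le:
  assumes "q * card (near m r) * 4 \<le> 2 ^ m"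
  shows "2 * forb m 3 2 (copies (Suc q) I2)
    \<le> (m + 2) * 2 ^ m + 2 * (q * card (pairs m - near m r) + max_near m r q)"
  unfolding forb_I2
proof (rule Max_card_le[where m = m])
  let ?P = "\<lambda>X. X \<subseteq> cols m \<and> (\<forall>i<m. \<forall>j<m. i \<noteq> j \<longrightarrow> occ X 0 1 i j < Suc q \<or> occ X 1 0 i j < Suc q)"
  show "?P {}" by (simp add: occ_def)
  fix X assume P: "?P X"
  then have X: "X \<subseteq> cols m" by blast
  then have fX: "finite X" by (rule finite_cols_subset)
  \<comment> \<open>\<open>T i j\<close> selects 0 in row i and 1 in row j as the rare pattern. If
    both patterns are rare, the order of the indices breaks the tie, so that \<open>T\<close> is a
    tournament.\<close>
  define T where "T i j \<longleftrightarrow> i \<noteq> j \<and> (if i < j then occ X 0 1 i j \<le> q else \<not> occ X 0 1 j i \<le> q)" for i j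
  have tour: "T i j \<longleftrightarrow> \<not> T j i" if "i \<noteq> j" for i j using that unfolding T_def by auto
  have irrefl: "\<not> T i i" for i by (simp add: T_def)
  have Tq: "occ X 0 1 i j \<le> q" if "i < m" "j < m" "T i j" for i j
  proof (cases "i < j")
    case True
    then show ?thesis using that by (simp add: T_def)
  next
    case False
    then have "j \<noteq> i" "\<not> occ X 0 1 j i < Suc q" using that by (auto simp: T_def)
    then have "occ X 1 0 j i < Suc q" using P that by blast
    then show ?thesis using occ_sym[of X 1 0 j i] by simp
  qed
  show "2 * card X \<le> (m + 2) * 2 ^ m + 2 * (q * card (pairs m - near m r) + max_near m r q)"
  proof (cases "\<forall>i<m. \<forall>j<m. \<forall>k<m. T i j \<longrightarrow> T j k \<longrightarrow> T i k")
    case True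
    obtain \<sigma> where \<sigma>: "bij_betw \<sigma> {..<m} {..<m}" "\<And>i j. i < j \<Longrightarrow> j < m \<Longrightarrow> T (\<sigma> i) (\<sigma> j)"
      using transitive_tournament_sort[of m T] tour irrefl True by blast
    let ?f = "\<lambda>c. \<lambda>i\<in>{..<m}. c (\<sigma> i)"
    have \<sigma>m: "\<sigma> i < m" if "i < m" for i using \<sigma>(1) that by (auto simp: bij_betw_def)
    have inj: "inj_on ?f (cols m)"
    proof (rule inj_onI)
      fix c d assume cd: "c \<in> cols m" "d \<in> cols m" "?f c = ?f d"
      show "c = d"
      proof (rule PiE_ext[OF cd(1,2)[unfolded cols_def]])
        fix k assume "k \<in> {..<m}"
        then have "k \<in> \<sigma> ` {..<m}" using \<sigma>(1) by (simp add: bij_betw_def)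
        then obtain i where i: "i < m" "\<sigma> i = k" by auto
        then show "c k = d k" using fun_cong[OF cd(3), of i] by (simp del: restrict_ext)
      qed
    qed
    have "2 * card (?f ` X) \<le> (m + 2) * 2 ^ m + 2 * (q * card (pairs m - near m r) + max_near m r q)"
    proof (rule card_le_of_linear)
      show "?f ` X \<subseteq> cols m"
      proof (rule image_subsetI)
        fix c assume "c \<in> X"
        then have "c \<in> {..<m} \<rightarrow>\<^sub>E {..<3}" using X by (auto simp: cols_def)
        then have "c (\<sigma> i) \<in> {..<3}" if "i < m" for i using PiE_mem[of c "{..<m}" "\<lambda>_. {..<3}"] \<sigma>m[OF that] by simp
        then show "?f c \<in> cols m" unfolding cols_def restrict_PiE_iff by simp
      qed
      fix i j assume ij: "i < j" "j < m"
      have "{c \<in> ?f ` X. c i = 0 \<and> c j = 1} \<subseteq> ?f ` {c \<in> X. c (\<sigma> i) = 0 \<and> c (\<sigma> j) = 1}"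
        using ij by auto
      then have "occ (?f ` X) 0 1 i j \<le> card (?f ` {c \<in> X. c (\<sigma> i) = 0 \<and> c (\<sigma> j) = 1})"
        unfolding occ_def using fX by (intro card_mono) auto
      also have "\<dots> \<le> occ X 0 1 (\<sigma> i) (\<sigma> j)" unfolding occ_def using fX by (intro card_image_le) auto
      also have "\<dots> \<le> q" using ij \<sigma>m \<sigma>(2) by (intro Tq) auto
      finally show "occ (?f ` X) 0 1 i j \<le> q" .
    qed
    then show ?thesis using inj_on_subset[OF inj X] by (simp add: card_image)
  next
    case False
    \<comment> \<open>In a tournament a failure of transitivity closes up to a cyclic
      triple.\<close>
    then obtain u v w where uvw: "u < m" "v < m" "w < m" "T u v" "T v w" "\<not> T u w" by blast
    have ne: "u \<noteq> v" "v \<noteq> w" "u \<noteq> w" using uvw irrefl tour[of u v] by auto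
    then have "T w u" using tour[of w u] uvw(6) by blast
    let ?V = "\<lambda>\<pi> c. if T (fst \<pi>) (snd \<pi>) then c (fst \<pi>) = 0 \<and> c (snd \<pi>) = (1::nat)
      else c (snd \<pi>) = 0 \<and> c (fst \<pi>) = 1"
    let ?Z = "{c \<in> X. \<forall>\<pi>\<in>pairs m. \<not> ?V \<pi> c}"
    have "card {c \<in> X. ?V \<pi> c} \<le> q" if \<pi>: "\<pi> \<in> pairs m" for \<pi>
    proof -
      have lt: "fst \<pi> < m" "snd \<pi> < m" "fst \<pi> \<noteq> snd \<pi>" using \<pi> by (auto simp: pairs_def)
      show ?thesis
      proof (cases "T (fst \<pi>) (snd \<pi>)")
        case True
        then show ?thesis using Tq[OF lt(1,2) True] by (simp add: occ_def)
      next
        case False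
        then have "T (snd \<pi>) (fst \<pi>)" using tour[OF lt(3)] by blast
        from Tq[OF lt(2,1) this] show ?thesis using False by (simp add: occ_def)
      qed
    qed
    then have 1: "card X \<le> q * card (pairs m) + card ?Z"
      using fX by (intro card_le_remove) auto
    have Z: "\<not> (c i = 0 \<and> c j = 1)" if ij: "c \<in> ?Z" "i < m" "j < m" "T i j" for c i j
    proof (cases "i < j")
      case True
      then have "(i, j) \<in> pairs m" using ij by (simp add: pairs_def)
      then have "\<not> ?V (i, j) c" using ij(1) by blast
      then show ?thesis using ij(4) by simp
    next
      case False
      then have ji: "j \<noteq> i" "j < i" using ij(4) irrefl by (metis, metis linorder_neqE_nat)
      then have "(j, i) \<in> pairs m" using ij by (simp add: pairs_def)
      then have "\<not> ?V (j, i) c" using ij(1) by blast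
      moreover have "\<not> T j i" using tour[OF ji(1)] ij(4) by blast
      ultimately show ?thesis by simp
    qed
    let ?S = "{..<m} - {u, v, w}"
    have S: "{u, v, w} \<union> ?S = {..<m}" using uvw by auto
    have "card ?S = m - 3" using uvw ne by (subst card_Diff_subset) auto
    moreover have "card {u, v, w} \<le> card {..<m}" using uvw by (intro card_mono) auto
    ultimately have cS: "card ?S + 3 = m" using ne by simp
    have "4 * card ?Z \<le> (2 * card ?S + 9) * 2 ^ (card ?S + 3)"
    proof (rule card_le_of_misses_cyclic)
      show "?Z \<subseteq> {u, v, w} \<union> ?S \<rightarrow>\<^sub>E {..<3}" unfolding S using X by (auto simp: cols_def)
      fix i j assume ij: "i \<in> {u, v, w} \<union> ?S" "j \<in> {u, v, w} \<union> ?S" "i \<noteq> j"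
      then have ijm: "i < m" "j < m" unfolding S by auto
      have T01: "misses ?Z i j" if "i < m" "j < m" "T i j" for i j
        using Z[OF _ that] unfolding misses_def by (intro exI[of _ 0] exI[of _ 1] conjI) auto
      show "misses ?Z i j"
      proof (cases "T i j")
        case True
        then show ?thesis by (rule T01[OF ijm])
      next
        case False
        then have "T j i" using tour[OF ij(3)] by blast
        then show ?thesis by (intro misses_sym[OF T01[OF ijm(2,1)]])
      qed
    next
      fix c assume c: "c \<in> ?Z"
      show "\<not> (c u = 0 \<and> c v = 1) \<and> \<not> (c v = 0 \<and> c w = 1) \<and> \<not> (c w = 0 \<and> c u = 1)"
        using Z[OF c] uvw \<open>T w u\<close> by blast
    qed (use ne in auto)
    also have "2 * card ?S + 9 = 2 * m + 3" using cS by simp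
    \<comment> \<open>As 2m + 3 = 2(m + 2) - 1, the extra term 2^m is four times the loss.\<close>
    finally have 2: "4 * card ?Z + 2 ^ m \<le> 2 * ((m + 2) * 2 ^ m)" by (simp only: cS) (simp add: algebra_simps)
    have "card (pairs m) = card (pairs m - near m r) + card (near m r)"
      using card_Diff_subset[OF finite_near near_subset] card_mono[OF finite_pairs near_subset] by simp
    then have "q * card (pairs m) = q * card (pairs m - near m r) + q * card (near m r)"
      by (simp add: algebra_simps)
    then show ?thesis using assms by (rule double_le_of_cyclic[OF 1 2])
  qed
qed simp

section \<open>Independence of the number of rows\<close>

text \<open>The near families do not depend on the number of rows, because a column
  of \<open>near_bad m r\<close> is constantly 2 on the rows between the first and last \<open>r\<close> ones.\<close>

definition insert_row :: "nat \<Rightarrow> (nat \<Rightarrow> nat) \<Rightarrow> nat \<Rightarrow> nat" where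
  "insert_row r c k = (if k < r then c k else if k = r then 2 else c (k - 1))"

definition delete_row_at :: "nat \<Rightarrow> (nat \<Rightarrow> nat) \<Rightarrow> nat \<Rightarrow> nat" where
  "delete_row_at r c k = (if k < r then c k else c (Suc k))"

lemma delete_insert_row [simp]: "delete_row_at r (insert_row r c) = c"
  by (auto simp: fun_eq_iff insert_row_def delete_row_at_def)

lemma insert_delete_row: "c r = 2 \<Longrightarrow> insert_row r (delete_row_at r c) = c"
  by (auto simp: fun_eq_iff insert_row_def delete_row_at_def)

lemma insert_row_cols: "c \<in> cols m \<Longrightarrow> r \<le> m \<Longrightarrow> insert_row r c \<in> cols (Suc m)"
  unfolding cols_def PiE_iff insert_row_def extensional_def by auto

lemma delete_row_cols: "c \<in> cols (Suc m) \<Longrightarrow> r \<le> m \<Longrightarrow> delete_row_at r c \<in> cols m"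
  unfolding cols_def PiE_iff delete_row_at_def extensional_def by auto

text \<open>The new indices of two rows after an insertion at \<open>r\<close>. Row \<open>r\<close>
  itself is never hit; it holds a 2 and so belongs to no bad pair.\<close>

definition skip :: "nat \<Rightarrow> nat \<times> nat \<Rightarrow> nat \<times> nat" where
  "skip r \<pi> = (if fst \<pi> < r then fst \<pi> else Suc (fst \<pi>), if snd \<pi> < r then snd \<pi> else Suc (snd \<pi>))"

lemma bad_skip: "bad (skip r \<pi>) (insert_row r c) \<longleftrightarrow> bad \<pi> c"
  by (auto simp: bad_def skip_def insert_row_def)

lemma skip_pairs: "r \<le> m \<Longrightarrow> skip r \<pi> \<in> pairs (Suc m) \<longleftrightarrow> \<pi> \<in> pairs m"
  by (cases \<pi>) (auto simp: skip_def pairs_def split: if_splits)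

text \<open>The ends of a near pair lie among the first r and the last r rows. As 2r <= m, only the
  second end is shifted, so both sides of the inequality in \<open>near\<close> grow by 1.\<close>

lemma skip_near: "2 * r \<le> m \<Longrightarrow> skip r \<pi> \<in> near (Suc m) r \<longleftrightarrow> \<pi> \<in> near m r"
  by (cases \<pi>) (auto simp: skip_def pairs_def near_def split: if_splits)

lemma bad_insert_row:
  assumes "bad \<pi> (insert_row r c)" obtains \<rho> where "\<pi> = skip r \<rho>"
proof -
  have "fst \<pi> \<noteq> r" "snd \<pi> \<noteq> r" using assms by (auto simp: bad_def insert_row_def)
  then have "\<pi> = skip r (if fst \<pi> < r then fst \<pi> else fst \<pi> - 1, if snd \<pi> < r then snd \<pi> else snd \<pi> - 1)"
    by (auto simp: skip_def prod_eq_iff)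
  then show thesis by (rule that)
qed

lemma near_bad_insert_row:
  assumes "2 * r \<le> m" "c \<in> cols m"
  shows "insert_row r c \<in> near_bad (Suc m) r \<longleftrightarrow> c \<in> near_bad m r"
proof -
  have "r \<le> m" using assms(1) by simp
  note sp = skip_pairs[OF this]
  have "(\<exists>\<pi>\<in>pairs (Suc m). bad \<pi> (insert_row r c)) \<longleftrightarrow> (\<exists>\<pi>\<in>pairs m. bad \<pi> c)"
    using bad_insert_row bad_skip sp by metis
  moreover have "(\<forall>\<pi>\<in>pairs (Suc m). bad \<pi> (insert_row r c) \<longrightarrow> \<pi> \<in> near (Suc m) r)
      \<longleftrightarrow> (\<forall>\<pi>\<in>pairs m. bad \<pi> c \<longrightarrow> \<pi> \<in> near m r)"
    using bad_insert_row bad_skip sp skip_near[OF assms(1)] by metis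
  ultimately show ?thesis
    using assms(2) insert_row_cols[OF assms(2) \<open>r \<le> m\<close>] by (simp add: near_bad_def)
qed

text \<open>Some bad pair (i, j) spans row r. A 0 in row r would make (r, j) bad and a 1 would make
  (i, r) bad, but either pair has at least r rows outside its interval.\<close>

lemma near_bad_middle:
  assumes "2 * r \<le> m" "c \<in> near_bad (Suc m) r"
  shows "c r = 2"
proof -
  obtain i j where b: "(i, j) \<in> pairs (Suc m)" "bad (i, j) c" using assms(2) by (auto simp: near_bad_def)
  have near: "\<pi> \<in> near (Suc m) r" if "\<pi> \<in> pairs (Suc m)" "bad \<pi> c" for \<pi>
    using assms(2) that by (auto simp: near_bad_def)
  have ij: "i + Suc m \<le> j + r" "i < j" "j < Suc m" using near[OF b] by (auto simp: near_def pairs_def)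
  have "c r \<noteq> 0"
  proof
    assume "c r = 0"
    then have "(r, j) \<in> near (Suc m) r"
      using b ij assms(1) by (intro near) (auto simp: pairs_def bad_def)
    then show False using ij by (simp add: near_def)
  qed
  moreover have "c r \<noteq> 1"
  proof
    assume "c r = 1"
    then have "(i, r) \<in> near (Suc m) r"
      using b ij assms(1) by (intro near) (auto simp: pairs_def bad_def)
    then show False using assms(1) by (simp add: near_def)
  qed
  moreover have "c r < 3"
  proof -
    have "c \<in> {..<Suc m} \<rightarrow>\<^sub>E {..<3}" using assms(2) by (simp add: near_bad_def cols_def)
    from PiE_mem[OF this, of r] show ?thesis using assms(1) by simp
  qed
  ultimately show ?thesis by linarith
qed

lemma insert_row_near_families:
  assumes m: "2 * r \<le> m" and Y: "Y \<subseteq> cols m"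
  shows "insert_row r ` Y \<in> near_families (Suc m) r q \<longleftrightarrow> Y \<in> near_families m r q"
proof -
  have rm: "r \<le> m" using m by simp
  have inj: "inj_on (insert_row r) A" for A by (rule inj_on_inverseI[of _ "delete_row_at r"]) simp
  have c: "card {c \<in> insert_row r ` Y. bad (skip r \<pi>) c} = card {c \<in> Y. bad \<pi> c}" for \<pi>
  proof -
    have "{c \<in> insert_row r ` Y. bad (skip r \<pi>) c} = insert_row r ` {c \<in> Y. bad \<pi> c}"
      by (auto simp: bad_skip)
    then show ?thesis by (simp add: card_image inj)
  qed
  have "insert_row r ` Y \<subseteq> near_bad (Suc m) r \<longleftrightarrow> Y \<subseteq> near_bad m r"
    using near_bad_insert_row[OF m] Y by blast
  moreover have "(\<forall>\<pi>\<in>pairs (Suc m). card {c \<in> insert_row r ` Y. bad \<pi> c} \<le> q)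
    \<longleftrightarrow> (\<forall>\<pi>\<in>pairs m. card {c \<in> Y. bad \<pi> c} \<le> q)" (is "?l \<longleftrightarrow> ?r")
  proof
    assume ?l
    then show ?r using c skip_pairs[OF rm] by metis
  next
    assume r: ?r
    show ?l
    proof
      fix \<pi> assume \<pi>: "\<pi> \<in> pairs (Suc m)"
      show "card {c \<in> insert_row r ` Y. bad \<pi> c} \<le> q"
      proof (cases "\<exists>\<rho>. \<pi> = skip r \<rho>")
        case True
        then obtain \<rho> where "\<pi> = skip r \<rho>" by blast
        then show ?thesis using r \<pi> c[of \<rho>] skip_pairs[OF rm, of \<rho>] by simp
      next
        case False
        then have "{c \<in> insert_row r ` Y. bad \<pi> c} = {}" using bad_insert_row by blast
        then show ?thesis by (simp only: card.empty)
      qed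
    qed
  qed
  ultimately show ?thesis by (simp add: near_families_def)
qed

text \<open>Inserting a row of 2s is injective and, by \<open>near_bad_middle\<close>, yields every
  near family on one more row, with the same cardinality.\<close>

lemma max_near_Suc:
  assumes m: "2 * r \<le> m"
  shows "max_near (Suc m) r q = max_near m r q"
proof -
  have inj: "inj_on (insert_row r) A" for A by (rule inj_on_inverseI[of _ "delete_row_at r"]) simp
  have "near_families (Suc m) r q = (`) (insert_row r) ` near_families m r q"
  proof (intro equalityI subsetI)
    fix Z assume Z: "Z \<in> near_families (Suc m) r q"
    then have ZB: "Z \<subseteq> near_bad (Suc m) r" by (simp add: near_families_def)
    let ?Y = "delete_row_at r ` Z"
    have "?Y \<subseteq> cols m" using ZB near_bad_subset[of "Suc m" r] m by (auto intro!: delete_row_cols)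
    moreover have "insert_row r ` ?Y = (\<lambda>c. c) ` Z"
      unfolding image_image using near_bad_middle[OF m] ZB by (intro image_cong) (auto intro!: insert_delete_row)
    ultimately show "Z \<in> (`) (insert_row r) ` near_families m r q"
      using insert_row_near_families[OF m, of ?Y q] Z by (intro image_eqI[of _ _ ?Y]) simp_all
  next
    fix Z assume "Z \<in> (`) (insert_row r) ` near_families m r q"
    then obtain Y where Y: "Y \<in> near_families m r q" "Z = insert_row r ` Y" by blast
    then show "Z \<in> near_families (Suc m) r q"
      using insert_row_near_families[OF m near_families_subset[OF Y(1)]] by simp
  qed
  then have "card ` near_families (Suc m) r q = card ` near_families m r q"
    by (simp add: image_image card_image inj)
  then show ?thesis by (simp add: max_near_def)
qed

lemma max_near_indep: "2 * r \<le> m \<Longrightarrow> max_near m r q = max_near (2 * r) r q"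
  by (induction m rule: dec_induct) (auto simp: max_near_Suc)

section \<open>Estimates of the difference\<close>

text \<open>From an optimal near family drop the at most \<open>q\<close> columns for each pair in
  \<open>near m r - near m t\<close>; the rest lies in \<open>near_bad m t\<close>. In terms of the
  shortage: it is at least \<open>q * card (near m t) - card (near_bad m t)\<close>, which is useful
  once 2^t is well below \<open>q\<close>.\<close>

lemma max_near_le:
  assumes "t \<le> r"
  shows "max_near m r q + q * card (near m t) \<le> q * card (near m r) + card (near_bad m t)"
proof -
  obtain Y where Y: "Y \<in> near_families m r q" "card Y = max_near m r q" by (rule ex_max_near)
  have fY: "finite Y" using near_families_subset[OF Y(1)] by (rule finite_cols_subset)
  have YB: "Y \<subseteq> near_bad m r" and b: "\<And>\<pi>. \<pi> \<in> pairs m \<Longrightarrow> card {c \<in> Y. bad \<pi> c} \<le> q"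
    using Y(1) by (auto simp: near_families_def)
  have sub: "near m t \<subseteq> near m r" using assms by (auto simp: near_def)
  let ?Z = "{c \<in> Y. \<forall>\<pi>\<in>near m r - near m t. \<not> bad \<pi> c}"
  have "card Y \<le> q * card (near m r - near m t) + card ?Z"
    using b near_subset[of m r] fY by (intro card_le_remove) auto
  also have "card ?Z \<le> card (near_bad m t)"
  proof (intro card_mono subsetI)
    show "finite (near_bad m t)" using near_bad_subset by (rule finite_cols_subset)
    fix c assume "c \<in> ?Z"
    then show "c \<in> near_bad m t" using YB unfolding near_bad_def by blast
  qed
  finally have "card Y \<le> q * card (near m r - near m t) + card (near_bad m t)" by simp
  moreover have "card (near m r) = card (near m r - near m t) + card (near m t)"
    using sub by (simp add: card_Diff_subset card_mono)
  ultimately show ?thesis using Y(2) by (simp add: algebra_simps)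
qed

text \<open>A column of \<open>near_bad m t\<close> is determined by its first 0 (row \<open>u\<close>), its last 1
  (row \<open>v\<close>) and the set of its entries different from 2; that set has at most \<open>t + 1\<close>
  possible elements once the last 0 among the first \<open>t\<close> rows (row \<open>a\<close>) is fixed.\<close>

lemma card_near_bad_le:
  assumes m: "2 * t \<le> m"
  shows "card (near_bad m t) \<le> t * (t * (t * 2 ^ (t + 1)))"
proof -
  \<comment> \<open>Rows strictly between a and m - t + a hold only 2: a 1 there would be bad with
    row a without being near, and a 0 either contradicts the choice of a or is bad with row v
    without being near. The remaining rows number (a + 1) + (t - a).\<close>
  let ?N = "\<lambda>a. {..a} \<union> {m - t + a..<m}"
  let ?D = "{..<t} \<times> {m - t..<m} \<times> (\<Union>a\<in>{..<t}. Pow (?N a))"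
  \<comment> \<open>Entries other than 2 are forced: no 0 before u, no 1 in the rows from u to t -
    1, no 0 from t to v, no 1 after v.\<close>
  let ?f = "\<lambda>(u, v, N). \<lambda>k\<in>{..<m}. if k \<notin> N then 2 else if k < u then 1 else if k < t then 0
    else if k \<le> v then 1 else (0::nat)"
  have "near_bad m t \<subseteq> ?f ` ?D"
  proof
    fix c assume c: "c \<in> near_bad m t"
    then have cP: "c \<in> {..<m} \<rightarrow>\<^sub>E {..<3}" by (simp add: near_bad_def cols_def)
    have c3: "c k < 3" if "k < m" for k using PiE_mem[OF cP, of k] that by simp
    have near: "i + m \<le> j + t" if "i < j" "j < m" "c i = 0" "c j = 1" for i j
    proof -
      have "(i, j) \<in> near m t" using c that unfolding near_bad_def by (auto simp: pairs_def bad_def)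
      then show ?thesis by (simp add: near_def)
    qed
    obtain i j where ij: "i < j" "j < m" "c i = 0" "c j = 1"
      using c by (auto simp: near_bad_def pairs_def bad_def)
    have it: "i < t" using near[OF ij] ij(2) by linarith
    define u where "u = (LEAST k. c k = 0)"
    have u: "c u = 0" "u \<le> i" "\<And>k. k < u \<Longrightarrow> c k \<noteq> 0"
      unfolding u_def using ij(3) by (auto intro: LeastI Least_le dest: not_less_Least)
    define v where "v = Max {k. k < m \<and> c k = 1}"
    have vs: "v \<in> {k. k < m \<and> c k = 1}" unfolding v_def using ij by (intro Max_in) auto
    have vm: "k \<le> v" if "k < m" "c k = 1" for k unfolding v_def using that by (intro Max_ge) auto
    define a where "a = Max {k. k < t \<and> c k = 0}"
    have as: "a \<in> {k. k < t \<and> c k = 0}" unfolding a_def using ij it by (intro Max_in) auto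
    have am: "k \<le> a" if "k < t" "c k = 0" for k unfolding a_def using that by (intro Max_ge) auto
    have jv: "j \<le> v" using vm ij by blast
    have ua: "u \<le> a" using am[of u] u(1,2) it by linarith
    have uv: "u + m \<le> v + t" using near[of u v] u vs jv ij by auto
    have av: "a + m \<le> v + t"
      using near[of a v] as vs uv m by auto
    have ge_u: "c k \<noteq> 1" if "u < k" "k < t" for k
      using near[of u k] that u m by auto
    have low: "c k \<noteq> 1" if "a < k" "k < m" "k < m - t + a" for k
      using near[of a k] that as by auto
    have mid: "c k \<noteq> 0" if "t \<le> k" "k < v" for k
      using near[of k v] that vs by auto
    let ?S = "{k. k < m \<and> c k \<noteq> 2}"
    have "?S \<subseteq> ?N a"
    proof
      fix k assume k: "k \<in> ?S"
      show "k \<in> ?N a"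
      proof (rule ccontr)
        assume "k \<notin> ?N a"
        then have k': "a < k" "k < m - t + a" using k by auto
        then have "c k \<noteq> 1" using low[of k] k by blast
        then have "c k = 0" using c3[of k] k by auto
        moreover have "\<not> k < t" using am[of k] \<open>c k = 0\<close> k' by auto
        moreover have "k < v" using k' av m by linarith
        ultimately show False using mid[of k] by simp
      qed
    qed
    then have "(u, v, ?S) \<in> ?D"
      using as uv vs u it m by auto
    moreover have "c = ?f (u, v, ?S)"
    proof
      fix k
      show "c k = ?f (u, v, ?S) k"
      proof (cases "k < m")
        case False
        then show ?thesis using PiE_arb[OF cP] by simp
      next
        case True
        consider "c k = 2" | "c k = 0" | "c k = 1" using c3[OF True] by linarith
        then show ?thesis
        proof cases
          case 1
          then show ?thesis using True by simp
        next
          case 2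
          have "\<not> k < u" using u(3) 2 by blast
          moreover have "k < t \<or> \<not> k \<le> v" using mid[of k] 2 vs by (cases "k = v") auto
          ultimately show ?thesis using 2 True by auto
        next
          case 3
          have "k < u \<or> \<not> k < t" using ge_u[of k] 3 u(1) by (cases "k = u") auto
          moreover have "k \<le> v" using vm[OF True 3] .
          ultimately show ?thesis using 3 True by auto
        qed
      qed
    qed
    ultimately show "c \<in> ?f ` ?D" by (rule rev_image_eqI)
  qed
  moreover have fD: "finite ?D" by auto
  ultimately have "card (near_bad m t) \<le> card ?D" by (rule surj_card_le[rotated])
  also have "\<dots> = t * (t * card (\<Union>a\<in>{..<t}. Pow (?N a)))"
    using m by (simp add: card_cartesian_product)
  also have "card (\<Union>a\<in>{..<t}. Pow (?N a)) \<le> (\<Sum>a<t. card (Pow (?N a)))"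
    by (rule card_UN_le) simp
  also have "\<dots> \<le> (\<Sum>a<t. 2 ^ (t + 1))"
  proof (rule sum_mono)
    fix a assume a: "a \<in> {..<t}"
    have "card (?N a) \<le> card {..a} + card {m - t + a..<m}" by (rule card_Un_le)
    also have "\<dots> = t + 1" using a m by simp
    finally have "(2::nat) ^ card (?N a) \<le> 2 ^ (t + 1)" by (intro power_increasing) auto
    then show "card (Pow (?N a)) \<le> 2 ^ (t + 1)" by (simp only: card_Pow finite_Un finite_atMost finite_atLeastLessThan)
  qed
  finally show ?thesis by simp
qed

section \<open>The exact difference and its asymptotics\<close>

text \<open>Bounds the number r(r + 1)/2 of near pairs by 2^r, as \<open>gdiff_eq\<close>
  requires.\<close>

lemma le_two_power: "r * (r + 1) \<le> 2 * 2 ^ r" for r :: nat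
proof (cases "r < 3")
  case True
  then have "r = 0 \<or> r = 1 \<or> r = 2" by linarith
  then show ?thesis by auto
next
  case False
  then have "3 \<le> r" by simp
  then show ?thesis
  proof (induction r rule: dec_induct)
    case (step n)
    have "Suc n * (Suc n + 1) = n * (n + 1) + 2 * (n + 1)" by (simp add: algebra_simps)
    also have "2 * (n + 1) \<le> n * (n + 1)" using step by (intro mult_right_mono) auto
    finally show ?case using step.IH by simp
  qed simp
qed

lemma rnum_bounds:
  assumes "2 \<le> p"
  shows "log 2 (real (p - 1)) \<le> rnum p" "rnum p \<le> log 2 (real p) + 1" "p - 1 \<le> 2 ^ rnum p"
proof -
  have p1: "real p - 1 = real (p - 1)" using assms by simp
  \<comment> \<open>Since p >= 2, the function \<open>nat\<close> in \<open>rnum\<close> truncates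
    nothing.\<close>
  have "0 \<le> log 2 (real (p - 1))" using assms by simp
  then have r: "real (rnum p) = of_int \<lceil>log 2 (real (p - 1))\<rceil>" unfolding rnum_def p1 by simp
  show 1: "log 2 (real (p - 1)) \<le> rnum p" unfolding r by simp
  have "log 2 (real (p - 1)) \<le> log 2 (real p)" using assms by simp
  then show "rnum p \<le> log 2 (real p) + 1" unfolding r by linarith
  have "real (p - 1) \<le> 2 powr (rnum p)" using 1 assms by (simp add: log_le_iff)
  then have "real (p - 1) \<le> real (2 ^ rnum p)" by (simp add: powr_realpow)
  then show "p - 1 \<le> 2 ^ rnum p" by (simp only: of_nat_le_iff)
qed

text \<open>The terms b(m) and the quotas of the far pairs cancel. The threshold on m is used twice:
  p - 1 <= 2^r <= 2^(m - 2) saturates all pairs for K_2, and the total near quota, at most 2^r 2^r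
  <= 2^(m - 2), does not exceed the loss of a cyclic orientation for I_2.\<close>

lemma gdiff_eq:
  assumes p: "2 \<le> p" and m: "2 * rnum p + 2 \<le> m"
  shows "gdiff m p = int ((p - 1) * card (near m (rnum p))) - int (max_near m (rnum p) (p - 1))"
proof -
  let ?r = "rnum p" and ?q = "p - 1"
  have p': "p = Suc ?q" using p by simp
  have q: "?q \<le> 2 ^ ?r" using rnum_bounds(3)[OF p] .
  also have "(2::nat) ^ ?r \<le> 2 ^ (m - 2)" using m by (intro power_increasing) auto
  finally have K: "2 * forb m 3 2 (copies (Suc ?q) K2) = (m + 2) * 2 ^ m + 2 * (?q * card (pairs m))"
    by (rule forb_K2_eq)
  have near: "2 * card (near m ?r) = ?r * (?r + 1)" using m by (intro two_card_near) simp
  have "?q * card (near m ?r) * 4 = 2 * (?q * (2 * card (near m ?r)))" by simp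
  also have "\<dots> \<le> 2 * (2 ^ ?r * (2 * 2 ^ ?r))"
    unfolding near using mult_le_mono[OF q le_two_power] by (rule mult_le_mono2)
  also have "\<dots> = 2 ^ (2 * ?r + 2)" by (simp add: power_add mult_2 distrib_left)
  also have "\<dots> \<le> 2 ^ m" using m by (intro power_increasing) auto
  finally have "?q * card (near m ?r) * 4 \<le> 2 ^ m" .
  from forb_I2_le[OF this] forb_I2_ge[OF q, of m]
  have I: "2 * forb m 3 2 (copies (Suc ?q) I2) =
    (m + 2) * 2 ^ m + 2 * (?q * card (pairs m - near m ?r) + max_near m ?r ?q)" by (rule antisym)
  have "card (pairs m) = card (pairs m - near m ?r) + card (near m ?r)"
    using card_Diff_subset[OF finite_near near_subset] card_mono[OF finite_pairs near_subset] by simp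
  then have "?q * card (pairs m) = ?q * card (pairs m - near m ?r) + ?q * card (near m ?r)"
    by (simp only: distrib_left)
  then have "forb m 3 2 (copies (Suc ?q) K2) + max_near m ?r ?q =
      forb m 3 2 (copies (Suc ?q) I2) + ?q * card (near m ?r)"
    using K I by simp
  then have "int (forb m 3 2 (copies p K2)) + int (max_near m ?r ?q) =
      int (forb m 3 2 (copies p I2)) + int (?q * card (near m ?r))"
    unfolding p'[symmetric] by (simp only: of_nat_add[symmetric])
  then show ?thesis unfolding gdiff_def by simp
qed

lemma gdiff_indep:
  assumes "2 \<le> p" "2 * rnum p + 2 \<le> m"
  shows "gdiff m p = gdiff (2 * rnum p + 2) p"
proof -
  have "2 * card (near m (rnum p)) = 2 * card (near (2 * rnum p + 2) (rnum p))"
    using assms by (simp only: two_card_near)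
  moreover have "max_near m (rnum p) q = max_near (2 * rnum p + 2) (rnum p) q" for q
    using max_near_indep[of "rnum p" m q] max_near_indep[of "rnum p" "2 * rnum p + 2" q] assms by simp
  ultimately show ?thesis using assms by (simp add: gdiff_eq)
qed

lemma gdiff_le:
  assumes "2 \<le> p"
  shows "real_of_int (gdiff (2 * rnum p + 2) p) \<le> real (p - 1) * (rnum p * (rnum p + 1)) / 2"
proof -
  let ?m = "2 * rnum p + 2"
  have "2 * card (near ?m (rnum p)) = rnum p * (rnum p + 1)" by (intro two_card_near) simp
  then have "2 * real (card (near ?m (rnum p))) = rnum p * (rnum p + 1)"
    by (metis of_nat_mult of_nat_numeral)
  then have n: "real (card (near ?m (rnum p))) = rnum p * (rnum p + 1) / 2" by simp
  moreover have "real_of_int (gdiff ?m p) \<le> real (p - 1) * card (near ?m (rnum p))"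
    using assms by (simp add: gdiff_eq)
  ultimately show ?thesis unfolding n by (simp only: times_divide_eq_right)
qed

lemma gdiff_ge:
  assumes p: "2 \<le> p" and t: "t \<le> rnum p"
  shows "real (p - 1) * (t * (t + 1)) / 2 - real t ^ 3 * 2 ^ (t + 1) \<le> real_of_int (gdiff (2 * rnum p + 2) p)"
proof -
  let ?m = "2 * rnum p + 2"
  have "2 * card (near ?m t) = t * (t + 1)" using t by (intro two_card_near) simp
  then have "2 * real (card (near ?m t)) = t * (t + 1)"
    by (metis of_nat_mult of_nat_numeral)
  then have n: "real (card (near ?m t)) = t * (t + 1) / 2" by simp
  have "max_near ?m (rnum p) (p - 1) + (p - 1) * card (near ?m t)
      \<le> (p - 1) * card (near ?m (rnum p)) + card (near_bad ?m t)"
    by (rule max_near_le[OF t])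
  moreover have "card (near_bad ?m t) \<le> t ^ 3 * 2 ^ (t + 1)"
    using card_near_bad_le[of t ?m] t by (simp add: power3_eq_cube algebra_simps)
  ultimately have "max_near ?m (rnum p) (p - 1) + (p - 1) * card (near ?m t)
      \<le> (p - 1) * card (near ?m (rnum p)) + t ^ 3 * 2 ^ (t + 1)" by linarith
  then have "real (max_near ?m (rnum p) (p - 1) + (p - 1) * card (near ?m t))
      \<le> real ((p - 1) * card (near ?m (rnum p)) + t ^ 3 * 2 ^ (t + 1))" by (simp only: of_nat_le_iff)
  then have "real (p - 1) * card (near ?m t) - real t ^ 3 * 2 ^ (t + 1) \<le> real_of_int (gdiff ?m p)"
    using p by (simp add: gdiff_eq)
  then show ?thesis unfolding n by (simp only: times_divide_eq_right)
qed

text \<open>With \<open>L = log 2 p\<close>, the choice \<open>t = \<lfloor>L - 5 log 2 L\<rfloor>\<close> makes \<open>t ^ 3 * 2 ^ t\<close> negligible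
  against \<open>p * L ^ 2\<close> while \<open>t\<close> is still asymptotic to \<open>L\<close>.\<close>

lemma gdiff_asymptotics:
  "(\<lambda>p. real_of_int (gdiff (2 * rnum p + 2) p) / (1/2 * real p * (log 2 (real p))^2)) \<longlonglongrightarrow> 1"
proof -
  define L where "L p = log 2 (real p)" for p :: nat
  define s where "s p = L p - 5 * log 2 (L p)" for p
  \<comment> \<open>\<open>?lo\<close> estimates the floor t of s by s - 1 <= t, and
    \<open>?hi\<close> uses \<open>rnum p \<le> L p + 1\<close>. Both tend to 1 because s / L
    does.\<close>
  let ?lo = "\<lambda>p. ((real p - 1) * ((s p - 1) * s p) / 2 - 2 * real p / L p ^ 2) / (1/2 * real p * L p ^ 2)"
  let ?hi = "\<lambda>p. (real p * ((L p + 1) * (L p + 2)) / 2) / (1/2 * real p * L p ^ 2)"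
  have "\<forall>\<^sub>F p in sequentially. s p \<ge> 1"
    unfolding s_def L_def log_def by real_asymp
  moreover have "\<forall>\<^sub>F p in sequentially. log 2 (L p) \<ge> 1"
    unfolding L_def log_def by real_asymp
  moreover have "\<forall>\<^sub>F p in sequentially. L p \<ge> 1"
    unfolding L_def log_def by real_asymp
  ultimately have "\<forall>\<^sub>F p in sequentially. 2 \<le> p \<and> s p \<ge> 1 \<and> log 2 (L p) \<ge> 1 \<and> L p \<ge> 1"
    using eventually_ge_at_top[of "2::nat"] by eventually_elim blast
  then have "\<forall>\<^sub>F p in sequentially.
    ?lo p \<le> real_of_int (gdiff (2 * rnum p + 2) p) / (1/2 * real p * L p ^ 2) \<and>
    real_of_int (gdiff (2 * rnum p + 2) p) / (1/2 * real p * L p ^ 2) \<le> ?hi p"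
  proof eventually_elim
    case (elim p)
    then have p: "2 \<le> p" and s1: "s p \<ge> 1" and LL: "log 2 (L p) \<ge> 1" and L1: "L p \<ge> 1" by auto
    have p1: "real (p - 1) = real p - 1" using p by simp
    have den: "0 \<le> 1/2 * real p * L p ^ 2" by simp
    have "real_of_int (gdiff (2 * rnum p + 2) p) \<le> real (p - 1) * (rnum p * (rnum p + 1)) / 2"
      by (rule gdiff_le[OF p])
    also have "\<dots> \<le> real p * ((L p + 1) * (L p + 2)) / 2"
      unfolding of_nat_mult
      using rnum_bounds(2)[OF p] L1 unfolding L_def[symmetric]
      by (intro divide_right_mono mult_mono) auto
    finally have hi: "real_of_int (gdiff (2 * rnum p + 2) p) \<le> real p * ((L p + 1) * (L p + 2)) / 2" .
    define t where "t = nat \<lfloor>s p\<rfloor>"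
    have "real t = of_int \<lfloor>s p\<rfloor>" using s1 unfolding t_def by simp
    then have t: "s p - 1 \<le> real t" "real t \<le> s p" by linarith+
    \<comment> \<open>Passing from p - 1 to p / 2 costs at most 1 in the logarithm, which s <= L - 5
      absorbs.\<close>
    have "real p / 2 \<le> real (p - 1)" using p1 p by simp
    then have "log 2 (real p / 2) \<le> log 2 (real (p - 1))" using p by simp
    then have "L p - 1 \<le> rnum p"
      using rnum_bounds(1)[OF p] p by (simp add: L_def log_divide)
    then have "real t \<le> real (rnum p)" using t(2) LL unfolding s_def by linarith
    then have tr: "t \<le> rnum p" by simp
    have "real t ^ 3 * 2 ^ (t + 1) = real t ^ 3 * (2 * 2 powr real t)" by (simp add: powr_realpow)
    \<comment> \<open>Here t <= L and 2^t <= 2^s = p / L^5; the resulting 2p / L^2 is far below the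
      main term of order p L^2.\<close>
    also have "\<dots> \<le> L p ^ 3 * (2 * (real p / L p ^ 5))"
    proof (intro mult_mono power_mono)
      show "real t \<le> L p" using t(2) LL unfolding s_def by linarith
      have "2 powr real t \<le> 2 powr s p" using t(2) by simp
      also have "\<dots> = 2 powr L p / 2 powr (5 * log 2 (L p))" unfolding s_def by (rule powr_diff)
      also have "2 powr L p = real p" using p by (simp add: L_def)
      also have "2 powr (5 * log 2 (L p)) = (2 powr log 2 (L p)) powr 5"
        by (simp add: powr_powr mult.commute)
      also have "\<dots> = L p ^ 5" using L1 by (simp add: powr_numeral)
      finally show "2 powr real t \<le> real p / L p ^ 5" .
    qed (use L1 in auto)
    also have "\<dots> = 2 * real p / L p ^ 2"
      using L1 by (simp add: field_simps power_numeral_reduce)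
    finally have t3: "real t ^ 3 * 2 ^ (t + 1) \<le> 2 * real p / L p ^ 2" .
    have "(real p - 1) * ((s p - 1) * s p) / 2 \<le> real (p - 1) * (t * (t + 1)) / 2"
      unfolding p1 of_nat_mult using t s1 p by (intro divide_right_mono mult_mono) auto
    then have lo: "(real p - 1) * ((s p - 1) * s p) / 2 - 2 * real p / L p ^ 2
        \<le> real_of_int (gdiff (2 * rnum p + 2) p)"
      using t3 gdiff_ge[OF p tr] by linarith
    show ?case using divide_right_mono[OF lo den] divide_right_mono[OF hi den] by blast
  qed
  then have ev: "\<forall>\<^sub>F p in sequentially. ?lo p \<le> real_of_int (gdiff (2 * rnum p + 2) p) / (1/2 * real p * L p ^ 2)"
    "\<forall>\<^sub>F p in sequentially. real_of_int (gdiff (2 * rnum p + 2) p) / (1/2 * real p * L p ^ 2) \<le> ?hi p"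
    by (simp_all add: eventually_conj_iff)
  have lo: "?lo \<longlonglongrightarrow> 1" unfolding s_def L_def log_def by (real_asymp, simp add: power2_eq_square)
  have hi: "?hi \<longlonglongrightarrow> 1" unfolding L_def log_def by (real_asymp, simp add: power2_eq_square)
  show ?thesis using tendsto_sandwich[OF ev lo hi] unfolding L_def .
qed

theorem mainTheorem2:
  shows "(\<forall>p\<ge>2. \<forall>m\<ge>2 * rnum p + 2. gdiff m p = gdiff (2 * rnum p + 2) p)
    \<and> (\<lambda>p. real_of_int (gdiff (2 * rnum p + 2) p) / (1/2 * real p * (log 2 (real p))^2))
        \<longlonglongrightarrow> 1"
  using gdiff_indep gdiff_asymptotics by blast

end
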